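(* Let $\lambda=\langle 0^{m_0},1^{m_1},\dots,s^{m_s}\rangle$ be a partition with $n=\sum_{r=0}^s m_r$ parts and $m_0\ge 1$, let $x_1,\dots,x_n>0$, and let $1\le k\le n-1$. Consider the multispecies PushTASEP on the ring with content $\lambda$ and site parameters $x_1,\dots,x_n$, started either in the stationary distribution, or in any (deterministic) starting configuration $\eta\in\Omega_\lambda$ with $\eta_{k+1}\ge\eta_{k+2}\ge\cdots\ge\eta_n$. Then the distribution of the path of the process (over times in $[0,\infty)$) observed on sites $1,2,\dots,k$ is invariant under permutations of the parameters $x_{k+1},\dots,x_n$. (In the stationary case, the process with permuted parameters is started from the stationary distribution for the permuted parameters; in the other case both are started from the same configuration $\eta$.)
   Context: **Content and configurations.** $\langle 0^{m_0},1^{m_1},\dots,s^{m_s}\rangle$ denotes the partition (weakly decreasing tuple) $\lambda$ of length $n$ with exactly $m_r$ parts equal to $r$. $\Omega_\lambda$ is the set of all distinct rearrangements $\eta=(\eta_1,\dots,\eta_n)$ of $\lambda$. **Multispecies PushTASEP.** The sites $1,2,\dots,n$ are arranged clockwise on a ring (site $n$ is followed by site $1$). $\eta_j=r\ge1$ means that site $j$ holds a particle of species $r$; $\eta_j=0$ means that site $j$ is vacant. The process is the continuous-time Markov chain on $\Omega_\lambda$ in which a bell rings at each site $j$ independently at rate $1/x_j$. If site $j$ is vacant when its bell rings, nothing changes. Otherwise let $i_1=\eta_j$; this particle moves to the first site $j_2$ clockwise from $j$ with $i_2:=\eta_{j_2}<i_1$. If $i_2=0$ the jump is complete; otherwise the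 displaced particle of species $i_2$ moves to the first site $j_3$ clockwise from $j_2$ with $\eta_{j_3}<i_2$, and so on until a vacancy is filled. All these moves occur instantaneously and site $j$ is left vacant. The chain is irreducible, so it has a unique stationary distribution. *)

theory Defs
  imports "HOL-Probability.Probability" "HOL-Combinatorics.Permutations"
begin

section \<open>Finite-state continuous-time Markov chains\<close>

text \<open>
  A chain on a finite set \<open>S\<close> is given by its jump rates \<open>q a b\<close> for \<open>a \<noteq> b\<close>; the values
  \<open>q a a\<close> are irrelevant.
\<close>

definition generator :: "'a set \<Rightarrow> ('a \<Rightarrow> 'a \<Rightarrow> real) \<Rightarrow> 'a \<Rightarrow> 'a \<Rightarrow> real" where
  "generator S q a b = (if a = b then - (\<Sum>c\<in>S - {a}. q a c) else q a b)"

fun gen_power :: "'a set \<Rightarrow> ('a \<Rightarrow> 'a \<Rightarrow> real) \<Rightarrow> nat \<Rightarrow> 'a \<Rightarrow> 'a \<Rightarrow> real" where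
  "gen_power S q 0 a b = (if a = b then 1 else 0)"
| "gen_power S q (Suc i) a b = (\<Sum>c\<in>S. generator S q a c * gen_power S q i c b)"

text \<open>The transition probabilities are the entries of the matrix exponential \<open>exp (t Q)\<close>.\<close>

definition trans_prob :: "'a set \<Rightarrow> ('a \<Rightarrow> 'a \<Rightarrow> real) \<Rightarrow> real \<Rightarrow> 'a \<Rightarrow> 'a \<Rightarrow> real" where
  "trans_prob S q t a b = (\<Sum>i. t ^ i / fact i * gen_power S q i a b)"

definition stationary_distribution :: "'a set \<Rightarrow> ('a \<Rightarrow> 'a \<Rightarrow> real) \<Rightarrow> 'a pmf \<Rightarrow> bool" where
  "stationary_distribution S q \<mu> \<longleftrightarrow>
     set_pmf \<mu> \<subseteq> S \<and>
     (\<forall>t\<ge>0. \<forall>b\<in>S. (\<Sum>a\<in>S. pmf \<mu> a * trans_prob S q t a b) = pmf \<mu> b)"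

text \<open>
  \<open>X\<close> is a right-continuous (for the discrete topology on \<open>S\<close>) Markov chain with jump rates
  \<open>q\<close> and initial distribution \<open>\<mu>\<close>, defined on the probability space \<open>M\<close>. Only times
  \<open>t \<ge> 0\<close> matter.
\<close>

definition markov_chain ::
  "'w measure \<Rightarrow> (real \<Rightarrow> 'w \<Rightarrow> 'a) \<Rightarrow> 'a set \<Rightarrow> ('a \<Rightarrow> 'a \<Rightarrow> real) \<Rightarrow> 'a pmf \<Rightarrow> bool" where
  "markov_chain M X S q \<mu> \<longleftrightarrow>
     prob_space M \<and> finite S \<and> set_pmf \<mu> \<subseteq> S \<and>
     (\<forall>t\<ge>0. X t \<in> measurable M (count_space S)) \<and>
     (\<forall>\<omega>\<in>space M. \<forall>t\<ge>0. \<exists>\<epsilon>>0. \<forall>u\<in>{t..<t + \<epsilon>}. X u \<omega> = X t \<omega>) \<and>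
     (\<forall>(l::nat) (t::nat \<Rightarrow> real) (a::nat \<Rightarrow> 'a).
        t 0 = 0 \<longrightarrow> (\<forall>i<l. t i \<le> t (Suc i)) \<longrightarrow> (\<forall>i\<le>l. a i \<in> S) \<longrightarrow>
        measure M {\<omega>\<in>space M. \<forall>i\<le>l. X (t i) \<omega> = a i} =
          pmf \<mu> (a 0) * (\<Prod>i<l. trans_prob S q (t (Suc i) - t i) (a i) (a (Suc i))))"

section \<open>The multispecies PushTASEP\<close>

text \<open>
  The configurations with content \<open>\<langle>0^(m 0), 1^(m 1), \<dots>, s^(m s)\<rangle>\<close>, that is, all distinct
  rearrangements of that partition, as extensional functions on the sites \<open>1, \<dots>, n\<close>, where
  \<open>n = (\<Sum>r\<le>s. m r)\<close>.
\<close>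

definition configs :: "nat \<Rightarrow> nat \<Rightarrow> (nat \<Rightarrow> nat) \<Rightarrow> (nat \<Rightarrow> nat) set" where
  "configs n s m =
     {\<eta> \<in> {1..n} \<rightarrow>\<^sub>E {0..s}. \<forall>r\<le>s. card {j\<in>{1..n}. \<eta> j = r} = m r}"

text \<open>The site reached from \<open>j\<close> by \<open>d\<close> clockwise steps on the ring \<open>1, \<dots>, n\<close>.\<close>

definition clockwise :: "nat \<Rightarrow> nat \<Rightarrow> nat \<Rightarrow> nat" where
  "clockwise n j d = (j - 1 + d) mod n + 1"

definition next_lower :: "nat \<Rightarrow> (nat \<Rightarrow> nat) \<Rightarrow> nat \<Rightarrow> nat \<Rightarrow> nat" where
  "next_lower n \<eta> i j = clockwise n j (LEAST d. 1 \<le> d \<and> \<eta> (clockwise n j d) < i)"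

text \<open>
  A particle of species \<open>i\<close> leaves site \<open>j\<close>, settles at the first site \<open>l\<close> holding a smaller
  value, and what was at \<open>l\<close> moves on. All searches are in the configuration \<open>\<eta>\<close> before
  the bell: a site passed through earlier in the cascade has a value in \<open>\<eta>\<close> that is too large
  to be chosen again. The condition \<open>\<eta> l < i\<close> fails precisely when \<open>i = 0\<close> (a vacancy has just
  been filled, and the cascade stops), provided that \<open>\<eta>\<close> has a vacancy.
\<close>

function push :: "nat \<Rightarrow> (nat \<Rightarrow> nat) \<Rightarrow> nat \<Rightarrow> nat \<Rightarrow> (nat \<Rightarrow> nat)" where
  "push n \<eta> i j =
     (let l = next_lower n \<eta> i j in
      if \<eta> l < i then (push n \<eta> (\<eta> l) l)(l := i) else \<eta>)"
  by pat_completeness auto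
termination by (relation "Wellfounded.measure (\<lambda>(n, \<eta>, i, j). i)") auto

declare push.simps [simp del]

definition bell :: "nat \<Rightarrow> nat \<Rightarrow> (nat \<Rightarrow> nat) \<Rightarrow> (nat \<Rightarrow> nat)" where
  "bell n j \<eta> = (if \<eta> j = 0 then \<eta> else (push n \<eta> (\<eta> j) j)(j := 0))"

definition pushtasep_rate ::
  "nat \<Rightarrow> (nat \<Rightarrow> real) \<Rightarrow> (nat \<Rightarrow> nat) \<Rightarrow> (nat \<Rightarrow> nat) \<Rightarrow> real" where
  "pushtasep_rate n x \<eta> \<zeta> = (\<Sum>j\<in>{j\<in>{1..n}. bell n j \<eta> = \<zeta>}. 1 / x j)"

text \<open>
  The law of the path \<open>t \<mapsto> (X t 1, \<dots>, X t k)\<close>, \<open>t \<in> [0, \<infinity>)\<close>, on the path space with the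
  \<open>\<sigma>\<close>-algebra generated by the evaluations at all times.
\<close>

definition observed_path_law ::
  "'w measure \<Rightarrow> (real \<Rightarrow> 'w \<Rightarrow> nat \<Rightarrow> nat) \<Rightarrow> nat \<Rightarrow> (real \<Rightarrow> nat \<Rightarrow> nat) measure" where
  "observed_path_law M X k =
     distr M (PiM {0..} (\<lambda>_. count_space UNIV)) (\<lambda>\<omega>. \<lambda>t\<in>{0..}. restrict (X t \<omega>) {1..k})"

end

theory Submission
  imports Defs
begin

text \<open>
  It suffices to exchange the parameters of two adjacent unobserved sites \<open>i\<close> and \<open>i + 1\<close>. Let \<open>K\<close>
  be the kernel that fixes \<open>\<eta>\<close> if \<open>\<eta> i \<ge> \<eta> (i + 1)\<close>, and otherwise keeps \<open>\<eta>\<close> with weight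
  \<open>x i / x (i + 1)\<close> and exchanges the contents of the two sites with the complementary weight.
  It intertwines the two generators and does not affect the observed sites, so the
  finite-dimensional distributions of the observed path agree as soon as the second initial
  distribution is the image of the first under \<open>K\<close>. Configurations that are weakly decreasing
  on the unobserved sites are fixed by \<open>K\<close>; the image of a stationary distribution is invariant
  for the second generator, hence stationary by uniqueness.

  The intertwining becomes a local computation once a bell is seen as a sweep: the content of
  the ringing site is carried around the ring, every site passed keeps the larger of its own
  value and the carried one, and the smaller one is carried on. Uniqueness holds because
  ringing the bells \<open>1, \<dots>, n\<close> in this order sorts every configuration.
\<close>


section \<open>Intertwined finite-state chains\<close>

lemma gen_power_bound:
  assumes "finite S" "a \<in> S"
  shows "\<bar>gen_power S q i a b\<bar> \<le> (\<Sum>c\<in>S. \<Sum>d\<in>S. \<bar>generator S q c d\<bar>) ^ i"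
  using assms(2)
proof (induction i arbitrary: a)
  case 0
  then show ?case by simp
next
  case (Suc i)
  \<comment> \<open>The sum of all absolute entries dominates every row sum, so each factor of the
    generator costs at most \<open>C\<close>. The bound is crude but makes the exponential series
    converge absolutely.\<close>
  define C where "C = (\<Sum>c\<in>S. \<Sum>d\<in>S. \<bar>generator S q c d\<bar>)"
  have C: "0 \<le> C"
    unfolding C_def by (intro sum_nonneg) auto
  have "\<bar>gen_power S q (Suc i) a b\<bar> \<le> (\<Sum>c\<in>S. \<bar>generator S q a c\<bar> * C ^ i)"
    unfolding gen_power.simps
  proof (rule order_trans[OF sum_abs sum_mono])
    fix c assume "c \<in> S"
    then show "\<bar>generator S q a c * gen_power S q i c b\<bar> \<le> \<bar>generator S q a c\<bar> * C ^ i"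
      using Suc.IH[of c] by (simp add: abs_mult C_def mult_left_mono)
  qed
  also have "\<dots> = (\<Sum>c\<in>S. \<bar>generator S q a c\<bar>) * C ^ i"
    by (simp add: sum_distrib_right)
  also have "\<dots> \<le> C * C ^ i"
    unfolding C_def using assms(1) Suc.prems
    by (intro mult_right_mono member_le_sum[where f = "\<lambda>c. \<Sum>d\<in>S. \<bar>generator S q c d\<bar>"])
      (auto intro!: sum_nonneg zero_le_power)
  finally show ?case by (simp add: C_def)
qed

lemma summable_trans_prob:
  assumes "finite S" "a \<in> S"
  shows "summable (\<lambda>i. t ^ i / fact i * gen_power S q i a b)"
proof (rule summable_comparison_test')
  let ?C = "\<Sum>c\<in>S. \<Sum>d\<in>S. \<bar>generator S q c d\<bar>"
  show "summable (\<lambda>i. inverse (fact i) * (\<bar>t\<bar> * ?C) ^ i)"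
    by (rule summable_exp)
  show "norm (t ^ i / fact i * gen_power S q i a b) \<le> inverse (fact i) * (\<bar>t\<bar> * ?C) ^ i" if "i \<ge> 0" for i
  proof -
    have "norm (t ^ i / fact i * gen_power S q i a b) = \<bar>t\<bar> ^ i / fact i * \<bar>gen_power S q i a b\<bar>"
      by (simp add: abs_mult power_abs)
    also have "\<dots> \<le> \<bar>t\<bar> ^ i / fact i * ?C ^ i"
      by (intro mult_left_mono gen_power_bound assms) auto
    finally show ?thesis by (simp add: power_mult_distrib field_simps)
  qed
qed

definition intertwines ::
  "'a set \<Rightarrow> ('a \<Rightarrow> 'a \<Rightarrow> real) \<Rightarrow> ('a \<Rightarrow> 'a \<Rightarrow> real) \<Rightarrow> ('a \<Rightarrow> 'a \<Rightarrow> real) \<Rightarrow> bool" where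
  "intertwines S K q q' \<longleftrightarrow>
     (\<forall>a\<in>S. \<forall>b\<in>S. (\<Sum>c\<in>S. generator S q a c * K c b) = (\<Sum>c\<in>S. K a c * generator S q' c b))"

text \<open>\<open>K\<close> moves through one factor at a time:
  \<open>Q^(i+1) K = Q (Q^i K) = Q K Q'^i = K Q' Q'^i\<close>.\<close>

lemma intertwines_gen_power:
  assumes "intertwines S K q q'" "a \<in> S" "b \<in> S" "finite S"
  shows "(\<Sum>c\<in>S. gen_power S q i a c * K c b) = (\<Sum>c\<in>S. K a c * gen_power S q' i c b)"
  using assms(2)
proof (induction i arbitrary: a)
  case 0
  have "(\<Sum>c\<in>S. gen_power S q 0 a c * K c b) = (\<Sum>c\<in>S. if c = a then K c b else 0)"
    by (intro sum.cong) auto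
  moreover have "(\<Sum>c\<in>S. K a c * gen_power S q' 0 c b) = (\<Sum>c\<in>S. if c = b then K a c else 0)"
    by (intro sum.cong) auto
  ultimately show ?case using 0 assms by simp
next
  case (Suc i)
  have "(\<Sum>c\<in>S. gen_power S q (Suc i) a c * K c b)
      = (\<Sum>d\<in>S. \<Sum>c\<in>S. generator S q a d * (gen_power S q i d c * K c b))"
    unfolding gen_power.simps sum_distrib_right
    by (subst sum.swap) (simp add: mult.assoc)
  also have "\<dots> = (\<Sum>d\<in>S. generator S q a d * (\<Sum>c\<in>S. K d c * gen_power S q' i c b))"
    by (simp add: sum_distrib_left[symmetric] Suc.IH)
  also have "\<dots> = (\<Sum>c\<in>S. (\<Sum>d\<in>S. generator S q a d * K d c) * gen_power S q' i c b)"
    unfolding sum_distrib_left sum_distrib_right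
    by (subst sum.swap) (simp add: mult.assoc)
  also have "\<dots> = (\<Sum>c\<in>S. (\<Sum>d\<in>S. K a d * generator S q' d c) * gen_power S q' i c b)"
    using assms(1) Suc.prems by (simp add: intertwines_def)
  also have "\<dots> = (\<Sum>c\<in>S. K a c * gen_power S q' (Suc i) c b)"
    unfolding gen_power.simps sum_distrib_left sum_distrib_right
    by (subst sum.swap) (simp add: mult.assoc)
  finally show ?case .
qed

lemma intertwines_trans_prob:
  assumes "intertwines S K q q'" "a \<in> S" "b \<in> S" "finite S"
  shows "(\<Sum>c\<in>S. trans_prob S q t a c * K c b) = (\<Sum>c\<in>S. K a c * trans_prob S q' t c b)"
proof -
  have "(\<Sum>c\<in>S. trans_prob S q t a c * K c b)
      = (\<Sum>c\<in>S. \<Sum>i. t ^ i / fact i * gen_power S q i a c * K c b)"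
    unfolding trans_prob_def
    by (intro sum.cong refl suminf_mult2 summable_trans_prob assms)
  also have "\<dots> = (\<Sum>i. \<Sum>c\<in>S. t ^ i / fact i * gen_power S q i a c * K c b)"
    by (intro suminf_sum[symmetric] summable_mult2 summable_trans_prob assms)
  also have "\<dots> = (\<Sum>i. t ^ i / fact i * (\<Sum>c\<in>S. gen_power S q i a c * K c b))"
    by (simp add: sum_distrib_left mult.assoc)
  also have "\<dots> = (\<Sum>i. \<Sum>c\<in>S. K a c * (t ^ i / fact i * gen_power S q' i c b))"
    by (simp add: intertwines_gen_power[OF assms] sum_distrib_left mult.left_commute)
  also have "\<dots> = (\<Sum>c\<in>S. \<Sum>i. K a c * (t ^ i / fact i * gen_power S q' i c b))"
    by (intro suminf_sum summable_mult summable_trans_prob assms)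
  also have "\<dots> = (\<Sum>c\<in>S. K a c * trans_prob S q' t c b)"
    unfolding trans_prob_def
    by (intro sum.cong refl suminf_mult summable_trans_prob assms)
  finally show ?thesis .
qed

lemma intertwines_compose:
  assumes "intertwines S K q q'" "intertwines S L q' q''"
  shows "intertwines S (\<lambda>a b. \<Sum>c\<in>S. K a c * L c b) q q''"
  unfolding intertwines_def
proof (intro ballI)
  fix a b assume ab: "a \<in> S" "b \<in> S"
  have "(\<Sum>c\<in>S. generator S q a c * (\<Sum>d\<in>S. K c d * L d b))
      = (\<Sum>d\<in>S. (\<Sum>c\<in>S. generator S q a c * K c d) * L d b)"
    unfolding sum_distrib_left sum_distrib_right by (subst sum.swap) (simp add: mult.assoc)
  also have "\<dots> = (\<Sum>d\<in>S. (\<Sum>c\<in>S. K a c * generator S q' c d) * L d b)"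
    using assms(1) ab by (simp add: intertwines_def)
  also have "\<dots> = (\<Sum>c\<in>S. K a c * (\<Sum>d\<in>S. generator S q' c d * L d b))"
    unfolding sum_distrib_left sum_distrib_right by (subst sum.swap) (simp add: mult.assoc)
  also have "\<dots> = (\<Sum>c\<in>S. K a c * (\<Sum>d\<in>S. L c d * generator S q'' d b))"
    using assms(2) ab by (simp add: intertwines_def)
  also have "\<dots> = (\<Sum>d\<in>S. (\<Sum>c\<in>S. K a c * L c d) * generator S q'' d b)"
    unfolding sum_distrib_left sum_distrib_right by (subst sum.swap) (simp add: mult.assoc)
  finally show "(\<Sum>c\<in>S. generator S q a c * (\<Sum>d\<in>S. K c d * L d b))
      = (\<Sum>d\<in>S. (\<Sum>c\<in>S. K a c * L c d) * generator S q'' d b)" .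
qed

text \<open>Stationarity says that the power series of \<open>\<mu> exp (t Q)\<close> at
  \<open>b\<close> is constant for \<open>t \<ge> 0\<close>. Its coefficient at \<open>t\<close> is
  \<open>\<mu> Q\<close>, which must therefore vanish.\<close>

lemma stationary_distribution_generator:
  assumes "finite S" "stationary_distribution S q \<mu>" "b \<in> S"
  shows "(\<Sum>a\<in>S. pmf \<mu> a * generator S q a b) = 0"
proof -
  define c where "c i = (\<Sum>a\<in>S. pmf \<mu> a * gen_power S q i a b / fact i)" for i
  have c: "c i * t ^ i = (\<Sum>a\<in>S. pmf \<mu> a * (t ^ i / fact i * gen_power S q i a b))" for i t
    by (simp add: c_def sum_distrib_left mult_ac)
  have summ: "summable (\<lambda>i. c i * t ^ i)" for t
    unfolding c by (intro summable_sum summable_mult summable_trans_prob assms)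
  have c_Suc: "summable (\<lambda>i. c (Suc i) * t ^ i)" for t
    using powser_split_head(3)[OF summ] .
  have h: "(\<Sum>i. c i * t ^ i) = pmf \<mu> b" if "t \<ge> 0" for t
  proof -
    have "(\<Sum>i. c i * t ^ i) = (\<Sum>a\<in>S. \<Sum>i. pmf \<mu> a * (t ^ i / fact i * gen_power S q i a b))"
      unfolding c by (intro suminf_sum summable_mult summable_trans_prob assms)
    also have "\<dots> = (\<Sum>a\<in>S. pmf \<mu> a * trans_prob S q t a b)"
      unfolding trans_prob_def
      by (intro sum.cong refl suminf_mult summable_trans_prob assms)
    finally show ?thesis using that assms by (auto simp: stationary_distribution_def)
  qed
  \<comment> \<open>\<open>g\<close> is the series minus its constant term, divided by
    \<open>t\<close>. It vanishes for \<open>t > 0\<close>, and continuity at 0 transfers this to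
    \<open>g 0\<close>, the linear coefficient. The limit is taken from the right because
    stationarity speaks only of \<open>t \<ge> 0\<close>.\<close>
  define g where "g t = (\<Sum>i. c (Suc i) * t ^ i)" for t
  have c0: "c 0 = pmf \<mu> b"
    using h[of 0] by simp
  have "g t = 0" if "t > 0" for t
    using powser_split_head(1)[OF summ[of t]] h[of t] that by (simp add: g_def c0)
  then have "eventually (\<lambda>t. g t = 0) (at_right 0)"
    by (auto simp: eventually_at_filter)
  then have "(g \<longlongrightarrow> 0) (at_right 0)"
    by (rule tendsto_eventually)
  moreover have "isCont g 0"
    unfolding g_def by (rule isCont_powser[OF c_Suc[of 1]]) simp
  then have "(g \<longlongrightarrow> g 0) (at_right 0)"
    unfolding isCont_def by (rule tendsto_within_subset) simp
  ultimately have "g 0 = 0"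
    using tendsto_unique by (metis trivial_limit_at_right_real)
  then have "c 1 = 0" by (simp add: g_def)
  moreover have "gen_power S q 1 a b = generator S q a b" for a
  proof -
    have "gen_power S q 1 a b = (\<Sum>c\<in>S. if c = b then generator S q a c else 0)"
      unfolding One_nat_def gen_power.simps by (intro sum.cong) auto
    then show ?thesis using assms by simp
  qed
  ultimately show ?thesis by (simp add: c_def)
qed


section \<open>Invariant measures of a generator and their uniqueness\<close>

lemma sum_generator_row:
  assumes "finite S" "a \<in> S"
  shows "(\<Sum>b\<in>S. generator S q a b * f b) = (\<Sum>b\<in>S. q a b * (f b - f a))"
proof -
  have "(\<Sum>b\<in>S. generator S q a b * f b)
      = generator S q a a * f a + (\<Sum>b\<in>S - {a}. generator S q a b * f b)"
    using assms by (rule sum.remove)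
  also have "\<dots> = (\<Sum>b\<in>S - {a}. q a b * (f b - f a))"
  proof -
    have "(\<Sum>b\<in>S - {a}. generator S q a b * f b) = (\<Sum>b\<in>S - {a}. q a b * f b)"
      by (intro sum.cong) (auto simp: generator_def)
    then show ?thesis
      by (simp add: generator_def right_diff_distrib sum_subtractf sum_distrib_right)
  qed
  \<comment> \<open>The added term \<open>b = a\<close> is zero whatever the meaningless rate
    \<open>q a a\<close> is.\<close>
  also have "\<dots> = (\<Sum>b\<in>S. q a b * (f b - f a))"
    using assms by (simp add: sum.remove[of S a])
  finally show ?thesis .
qed

text \<open>The triangle inequality in the balance equation at \<open>b\<close> makes every entry of
  \<open>\<bar>d\<bar> Q\<close> nonnegative. The entries sum to 0 because the rows of
  \<open>Q\<close> do, so all of them vanish.\<close>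

lemma generator_invariant_abs:
  assumes "finite S" and q: "\<And>a b. a \<in> S \<Longrightarrow> b \<in> S \<Longrightarrow> a \<noteq> b \<Longrightarrow> q a b \<ge> 0"
    and d: "\<And>b. b \<in> S \<Longrightarrow> (\<Sum>a\<in>S. d a * generator S q a b) = 0" and "b \<in> S"
  shows "(\<Sum>a\<in>S. \<bar>d a\<bar> * generator S q a b) = 0"
proof -
  define h where "h b = (\<Sum>a\<in>S. \<bar>d a\<bar> * generator S q a b)" for b
  have "h b \<ge> 0" if b: "b \<in> S" for b
  proof -
    have "d b * generator S q b b + (\<Sum>a\<in>S - {b}. d a * generator S q a b) = 0"
      using d[OF b] assms b by (simp add: sum.remove[of S b])
    then have "\<bar>d b * generator S q b b\<bar> = \<bar>\<Sum>a\<in>S - {b}. d a * generator S q a b\<bar>"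
      by linarith
    also have "\<dots> \<le> (\<Sum>a\<in>S - {b}. \<bar>d a * generator S q a b\<bar>)"
      by (rule sum_abs)
    also have "\<dots> = (\<Sum>a\<in>S - {b}. \<bar>d a\<bar> * generator S q a b)"
      using q b by (intro sum.cong) (auto simp: abs_mult generator_def)
    finally have "\<bar>d b * generator S q b b\<bar> \<le> (\<Sum>a\<in>S - {b}. \<bar>d a\<bar> * generator S q a b)" .
    moreover have "\<bar>d b * generator S q b b\<bar> \<ge> - (\<bar>d b\<bar> * generator S q b b)"
      by (metis abs_ge_minus_self abs_mult abs_abs)
    ultimately show ?thesis
      using assms b by (simp add: h_def sum.remove[of S b])
  qed
  moreover have "(\<Sum>b\<in>S. h b) = 0"
  proof -
    have "(\<Sum>b\<in>S. h b) = (\<Sum>a\<in>S. \<bar>d a\<bar> * (\<Sum>b\<in>S. generator S q a b * 1))"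
      unfolding h_def sum_distrib_left by (subst sum.swap) simp
    also have "\<dots> = 0"
      using sum_generator_row[OF assms(1), of _ q "\<lambda>_. 1"] by (intro sum.neutral) auto
    finally show ?thesis .
  qed
  ultimately show ?thesis
    using assms by (simp add: sum_nonneg_eq_0_iff h_def)
qed

text \<open>Mass spreads along edges: if \<open>p y > 0\<close> and \<open>q y z > 0\<close>, then
  the inflow into \<open>z\<close> is positive, and balance at \<open>z\<close> forces a positive
  outflow, hence \<open>p z > 0\<close>.\<close>

lemma generator_invariant_pos_reachable:
  assumes "finite S" and q: "\<And>a b. a \<in> S \<Longrightarrow> b \<in> S \<Longrightarrow> a \<noteq> b \<Longrightarrow> q a b \<ge> 0"
    and p: "\<And>b. b \<in> S \<Longrightarrow> (\<Sum>a\<in>S. p a * generator S q a b) = 0"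
    and nonneg: "\<And>a. a \<in> S \<Longrightarrow> p a \<ge> 0"
    and reach: "(a, z) \<in> {(a, b). a \<in> S \<and> b \<in> S \<and> q a b > 0}\<^sup>*" and "p a > 0"
  shows "p z > 0"
  using reach \<open>p a > 0\<close>
proof (induction rule: rtrancl_induct)
  case base
  then show ?case .
next
  case (step y z)
  then have yz: "y \<in> S" "z \<in> S" "q y z > 0" "p y > 0" by auto
  show ?case
  \<comment> \<open>The relation may contain loops, since \<open>q y y\<close> is
    unrestricted.\<close>
  proof (cases "y = z")
    case False
    have "0 < p y * q y z" using yz by simp
    also have "\<dots> \<le> (\<Sum>a\<in>S - {z}. p a * generator S q a z)"
    proof -
      have "p y * generator S q y z \<le> (\<Sum>a\<in>S - {z}. p a * generator S q a z)"
        using yz False assms(1) q nonneg by (intro member_le_sum) (auto simp: generator_def)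
      then show ?thesis using False by (simp add: generator_def)
    qed
    finally have "p z * generator S q z z < 0"
      using p[of z] yz assms(1) by (simp add: sum.remove[of S z])
    then show ?thesis using nonneg[of z] yz by (auto simp: less_le)
  qed (use yz in simp)
qed

text \<open>If the difference \<open>d\<close> is not zero, it takes both signs because its sum is
  0. Then \<open>\<bar>d\<bar> + d\<close> and \<open>\<bar>d\<bar> - d\<close> are nonnegative
  invariant measures, neither of them zero, and both are positive at the commonly reachable state
  \<open>z\<close>. This would make \<open>d z\<close> both positive and negative.\<close>

lemma generator_invariant_unique:
  assumes "finite S" and q: "\<And>a b. a \<in> S \<Longrightarrow> b \<in> S \<Longrightarrow> a \<noteq> b \<Longrightarrow> q a b \<ge> 0"
    and reach: "\<And>a. a \<in> S \<Longrightarrow> (a, z) \<in> {(a, b). a \<in> S \<and> b \<in> S \<and> q a b > 0}\<^sup>*"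
    and v: "\<And>b. b \<in> S \<Longrightarrow> (\<Sum>a\<in>S. v a * generator S q a b) = 0"
    and w: "\<And>b. b \<in> S \<Longrightarrow> (\<Sum>a\<in>S. w a * generator S q a b) = 0"
    and "(\<Sum>a\<in>S. v a) = (\<Sum>a\<in>S. w a)" and "a \<in> S"
  shows "v a = w a"
proof (rule ccontr)
  define d where "d a = v a - w a" for a
  assume "v a \<noteq> w a"
  then have "d a \<noteq> 0" by (simp add: d_def)
  have d: "(\<Sum>a\<in>S. d a * generator S q a b) = 0" if "b \<in> S" for b
    using v[OF that] w[OF that] by (simp add: d_def left_diff_distrib sum_subtractf)
  have sum_d: "(\<Sum>a\<in>S. d a) = 0"
    using assms by (simp add: d_def sum_subtractf)
  note abs_d = generator_invariant_abs[OF assms(1) q d]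
  have "\<exists>a\<in>S. d a > 0"
  proof (rule ccontr)
    assume "\<not> (\<exists>a\<in>S. d a > 0)"
    then have "\<forall>a\<in>S. - d a = 0"
      using assms(1) sum_d by (subst sum_nonneg_eq_0_iff[symmetric]) (auto simp: sum_negf not_less)
    then show False using \<open>d a \<noteq> 0\<close> \<open>a \<in> S\<close> by simp
  qed
  then obtain a1 where a1: "a1 \<in> S" "d a1 > 0" by blast
  have "\<exists>a\<in>S. d a < 0"
  proof (rule ccontr)
    assume "\<not> (\<exists>a\<in>S. d a < 0)"
    then have "\<forall>a\<in>S. d a = 0"
      using assms(1) sum_d by (subst sum_nonneg_eq_0_iff[symmetric]) (auto simp: not_less)
    then show False using \<open>d a \<noteq> 0\<close> \<open>a \<in> S\<close> by simp
  qed
  then obtain a2 where a2: "a2 \<in> S" "d a2 < 0" by blast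
  have "\<bar>d z\<bar> + d z > 0"
    using a1 d abs_d
    by (intro generator_invariant_pos_reachable[OF assms(1) q _ _ reach, of "\<lambda>a. \<bar>d a\<bar> + d a" a1])
      (auto simp: distrib_right sum.distrib)
  moreover have "\<bar>d z\<bar> - d z > 0"
    using a2 d abs_d
    by (intro generator_invariant_pos_reachable[OF assms(1) q _ _ reach, of "\<lambda>a. \<bar>d a\<bar> - d a" a2])
      (auto simp: left_diff_distrib sum_subtractf)
  ultimately show False by linarith
qed

section \<open>Finite-dimensional distributions\<close>

fun path_weight ::
  "'a set \<Rightarrow> (nat \<Rightarrow> 'a \<Rightarrow> 'a \<Rightarrow> real) \<Rightarrow> ('a \<Rightarrow> real) \<Rightarrow> (nat \<Rightarrow> 'a set) \<Rightarrow> nat \<Rightarrow> 'a \<Rightarrow> real" where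
  "path_weight S p w B 0 b = (if b \<in> B 0 then w b else 0)"
| "path_weight S p w B (Suc l) b =
     (if b \<in> B (Suc l) then \<Sum>a\<in>S. path_weight S p w B l a * p l a b else 0)"

text \<open>For transition matrices \<open>p\<close> and an initial law \<open>w\<close>,
  \<open>path_weight\<close> is the probability of staying in \<open>B 0, ..., B l\<close> and
  ending at \<open>b\<close>, computed by the forward recursion. The endpoint function
  \<open>g\<close> is arbitrary so that the induction can absorb the last step of a path into
  it.\<close>

lemma sum_paths:
  assumes "finite S" and B: "\<And>i. B i \<subseteq> S"
  shows "(\<Sum>a\<in>PiE {..l} B. w (a 0) * (\<Prod>i<l. p i (a i) (a (Suc i))) * g (a l))
       = (\<Sum>b\<in>S. path_weight S p w B l b * g b)"
proof (induction l arbitrary: g)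
  case 0
  have "PiE {..0} B = PiE (insert 0 {}) B" by (auto simp: PiE_def Pi_def extensional_def)
  also have "\<dots> = (\<lambda>y. (\<lambda>_. undefined)(0 := y)) ` B 0"
    unfolding PiE_insert_eq by (auto simp: image_iff)
  finally have "(\<Sum>a\<in>PiE {..0} B. w (a 0) * (\<Prod>i<0. p i (a i) (a (Suc i))) * g (a 0))
      = (\<Sum>b\<in>B 0. w b * g b)"
    by (simp add: sum.reindex inj_on_def fun_upd_eqD)
  also have "\<dots> = (\<Sum>b\<in>S. path_weight S p w B 0 b * g b)"
    using assms by (intro sum.mono_neutral_cong_left) auto
  finally show ?case .
next
  case (Suc l)
  have ins: "{..Suc l} = insert (Suc l) {..l}" by auto
  have "(\<Sum>a\<in>PiE {..Suc l} B. w (a 0) * (\<Prod>i<Suc l. p i (a i) (a (Suc i))) * g (a (Suc l)))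
      = (\<Sum>(y, a)\<in>B (Suc l) \<times> PiE {..l} B. w (a 0) * (\<Prod>i<l. p i (a i) (a (Suc i))) * (p l (a l) y * g y))"
    unfolding ins PiE_insert_eq
    by (subst sum.reindex[OF inj_combinator]) (auto intro!: sum.cong prod.cong simp: mult.assoc)
  also have "\<dots> = (\<Sum>a\<in>PiE {..l} B. w (a 0) * (\<Prod>i<l. p i (a i) (a (Suc i)))
                      * (\<Sum>y\<in>B (Suc l). p l (a l) y * g y))"
    unfolding sum.cartesian_product[symmetric] sum_distrib_left by (rule sum.swap)
  also have "\<dots> = (\<Sum>b\<in>S. path_weight S p w B l b * (\<Sum>y\<in>B (Suc l). p l b y * g y))"
    by (rule Suc.IH)
  also have "\<dots> = (\<Sum>y\<in>B (Suc l). path_weight S p w B (Suc l) y * g y)"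
    unfolding sum_distrib_left by (subst sum.swap) (simp add: sum_distrib_right mult.assoc)
  also have "\<dots> = (\<Sum>b\<in>S. path_weight S p w B (Suc l) b * g b)"
    using assms by (intro sum.mono_neutral_cong_left) auto
  finally show ?case .
qed

text \<open>The event splits into the disjoint events that the chain follows one particular path,
  whose probabilities are prescribed by \<open>markov_chain\<close>.\<close>

lemma markov_chain_prob:
  assumes chain: "markov_chain M X S q \<mu>" and t: "t 0 = 0" "\<And>i. i < l \<Longrightarrow> t i \<le> t (Suc i)"
    and B: "\<And>i. B i \<subseteq> S"
  shows "measure M {\<omega>\<in>space M. \<forall>i\<le>l. X (t i) \<omega> \<in> B i}
       = (\<Sum>b\<in>S. path_weight S (\<lambda>i. trans_prob S q (t (Suc i) - t i)) (pmf \<mu>) B l b)"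
proof -
  interpret prob_space M using chain by (simp add: markov_chain_def)
  have S: "finite S" and X: "\<And>t. t \<ge> 0 \<Longrightarrow> X t \<in> measurable M (count_space S)"
    using chain by (auto simp: markov_chain_def)
  have t_nonneg: "t i \<ge> 0" if "i \<le> l" for i
    using that
  proof (induction i)
    case (Suc i)
    then show ?case using t(2)[of i] by simp
  qed (simp add: t)
  define E where "E a = {\<omega>\<in>space M. \<forall>i\<le>l. X (t i) \<omega> = a i}" for a
  have E: "E a \<in> sets M" if "a \<in> PiE {..l} B" for a
  proof -
    have "E a = {\<omega>\<in>space M. \<forall>i\<in>{..l}. X (t i) \<omega> = a i}" by (auto simp: E_def)
    moreover have "{\<omega>\<in>space M. X (t i) \<omega> = a i} \<in> sets M" if "i \<in> {..l}" for i
    proof -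
      have "X (t i) -` {a i} \<inter> space M \<in> sets M"
        using that \<open>a \<in> PiE {..l} B\<close> B
        by (intro measurable_sets[OF X] t_nonneg) (auto simp: PiE_iff)
      then show ?thesis by (simp add: vimage_def Int_def conj_commute)
    qed
    ultimately show ?thesis using sets.sets_Collect_finite_All[of "{..l}" M] by simp
  qed
  have fin: "finite (PiE {..l} B)"
    using S B by (intro finite_PiE) (auto intro: finite_subset)
  have "{\<omega>\<in>space M. \<forall>i\<le>l. X (t i) \<omega> \<in> B i} = (\<Union>a\<in>PiE {..l} B. E a)"
  proof (intro equalityI subsetI)
    fix \<omega> assume "\<omega> \<in> {\<omega>\<in>space M. \<forall>i\<le>l. X (t i) \<omega> \<in> B i}"
    \<comment> \<open>Restricting to \<open>{..l}\<close> selects the extensional representative,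
      which makes the path unique and the union finite.\<close>
    then have "(\<lambda>i\<in>{..l}. X (t i) \<omega>) \<in> PiE {..l} B" "\<omega> \<in> E (\<lambda>i\<in>{..l}. X (t i) \<omega>)"
      by (auto simp: E_def)
    then show "\<omega> \<in> (\<Union>a\<in>PiE {..l} B. E a)" by blast
  qed (auto simp: E_def PiE_iff)
  moreover have "measure M (\<Union>a\<in>PiE {..l} B. E a) = (\<Sum>a\<in>PiE {..l} B. measure M (E a))"
  proof (rule finite_measure_finite_Union[OF fin])
    show "E ` PiE {..l} B \<subseteq> sets M" using E by auto
    show "disjoint_family_on E (PiE {..l} B)"
    proof (unfold disjoint_family_on_def, intro ballI impI)
      fix a b assume ab: "a \<in> PiE {..l} B" "b \<in> PiE {..l} B" "a \<noteq> b"
      then obtain i where "i \<in> {..l}" "a i \<noteq> b i" using PiE_ext by blast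
      then show "E a \<inter> E b = {}" by (auto simp: E_def)
    qed
  qed
  moreover have "measure M (E a) = pmf \<mu> (a 0) * (\<Prod>i<l. trans_prob S q (t (Suc i) - t i) (a i) (a (Suc i)))"
    if "a \<in> PiE {..l} B" for a
  proof -
    have "\<forall>i\<le>l. a i \<in> S" using that B by (fastforce simp: PiE_iff)
    then show ?thesis using chain t unfolding markov_chain_def E_def by blast
  qed
  ultimately show ?thesis
    using sum_paths[OF S B, where g = "\<lambda>_. 1" and l = l and w = "pmf \<mu>"
        and p = "\<lambda>i. trans_prob S q (t (Suc i) - t i)"] by simp
qed

text \<open>\<open>K\<close> never connects a state inside \<open>B i\<close> with one outside, so
  it commutes with conditioning on \<open>B i\<close>. Together with the intertwining of the
  transition probabilities this carries \<open>K\<close> from the initial weights to the final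
  ones.\<close>

lemma path_weight_intertwined:
  assumes "finite S" and K: "intertwines S K q q'"
    and KB: "\<And>i a b. a \<in> S \<Longrightarrow> b \<in> S \<Longrightarrow> K a b \<noteq> 0 \<Longrightarrow> a \<in> B i \<longleftrightarrow> b \<in> B i"
    and w: "\<And>b. b \<in> S \<Longrightarrow> w' b = (\<Sum>a\<in>S. w a * K a b)" and "b \<in> S"
  shows "path_weight S (\<lambda>i. trans_prob S q' (t i)) w' B l b
       = (\<Sum>a\<in>S. path_weight S (\<lambda>i. trans_prob S q (t i)) w B l a * K a b)"
  using \<open>b \<in> S\<close>
proof (induction l arbitrary: b)
  case 0
  show ?case
  proof (cases "b \<in> B 0")
    case True
    then have "K a b = 0" if "a \<in> S" "a \<notin> B 0" for a
      using KB[of a b 0] that 0 by blast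
    then show ?thesis using 0 True w by (auto intro!: sum.cong)
  next
    case False
    then have "K a b = 0" if "a \<in> S" "a \<in> B 0" for a
      using KB[of a b 0] that 0 by blast
    then show ?thesis using False by (auto intro!: sum.neutral)
  qed
next
  case (Suc l)
  let ?p = "path_weight S (\<lambda>i. trans_prob S q (t i)) w B l"
  show ?case
  proof (cases "b \<in> B (Suc l)")
    case True
    have "path_weight S (\<lambda>i. trans_prob S q' (t i)) w' B (Suc l) b
        = (\<Sum>a\<in>S. (\<Sum>c\<in>S. ?p c * K c a) * trans_prob S q' (t l) a b)"
      using True by (simp add: Suc.IH)
    also have "\<dots> = (\<Sum>c\<in>S. ?p c * (\<Sum>a\<in>S. K c a * trans_prob S q' (t l) a b))"
      unfolding sum_distrib_left sum_distrib_right by (subst sum.swap) (simp add: mult.assoc)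
    also have "\<dots> = (\<Sum>c\<in>S. ?p c * (\<Sum>a\<in>S. trans_prob S q (t l) c a * K a b))"
      using intertwines_trans_prob[OF K _ Suc.prems assms(1)] by simp
    also have "\<dots> = (\<Sum>a\<in>S. (\<Sum>c\<in>S. ?p c * trans_prob S q (t l) c a) * K a b)"
      unfolding sum_distrib_left sum_distrib_right by (subst sum.swap) (simp add: mult.assoc)
    also have "\<dots> = (\<Sum>a\<in>S. path_weight S (\<lambda>i. trans_prob S q (t i)) w B (Suc l) a * K a b)"
    proof -
      have "K a b = 0" if "a \<in> S" "a \<notin> B (Suc l)" for a
        using KB[of a b "Suc l"] that True Suc.prems by blast
      then show ?thesis by (auto intro!: sum.cong)
    qed
    finally show ?thesis .
  next
    case False
    then have "K a b = 0" if "a \<in> S" "a \<in> B (Suc l)" for a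
      using KB[of a b "Suc l"] that Suc.prems by blast
    then show ?thesis using False by (auto intro!: sum.neutral)
  qed
qed


section \<open>The bell as a sweep around the ring\<close>

lemma clockwise_in: "n > 0 \<Longrightarrow> clockwise n j d \<in> {1..n}"
  by (simp add: clockwise_def Suc_leI)

lemma clockwise_0: "j \<in> {1..n} \<Longrightarrow> clockwise n j 0 = j"
  by (auto simp: clockwise_def)

lemma clockwise_n: "j \<in> {1..n} \<Longrightarrow> clockwise n j n = j"
  unfolding clockwise_def by (subst mod_add_self2) auto

lemma clockwise_clockwise: "clockwise n (clockwise n j d) e = clockwise n j (d + e)"
  by (simp add: clockwise_def mod_add_left_eq add.assoc)

lemma clockwise_Suc:
  assumes "clockwise n j d < n"
  shows "clockwise n j (Suc d) = Suc (clockwise n j d)"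
  using assms by (simp add: clockwise_def mod_Suc)

lemma clockwise_inj:
  assumes "d < n" "e < n" "clockwise n j d = clockwise n j e"
  shows "d = e"
proof -
  have eq: "(j - 1 + d) mod n = (j - 1 + e) mod n"
    using assms(3) by (simp add: clockwise_def)
  have "d \<le> e" if "d < n" "e < n" "(j - 1 + d) mod n = (j - 1 + e) mod n" for d e
  proof (rule ccontr)
    assume "\<not> d \<le> e"
    then have "n dvd (j - 1 + d) - (j - 1 + e)"
      using that mod_eq_dvd_iff_nat[of "j - 1 + e" "j - 1 + d" n] by simp
    then show False
      using that \<open>\<not> d \<le> e\<close> by (auto dest: dvd_imp_le)
  qed
  from this[OF assms(1,2) eq] this[OF assms(2,1) eq[symmetric]] show ?thesis by simp
qed

lemma clockwise_surj:
  assumes "j \<in> {1..n}" "l \<in> {1..n}"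
  obtains d where "d < n" "clockwise n j d = l"
proof -
  have "clockwise n j ` {..<n} = {1..n}"
    using assms clockwise_in[of n j]
    by (intro card_subset_eq) (auto simp: card_image inj_on_def clockwise_inj)
  then show ?thesis using assms(2) that by (metis imageE lessThan_iff)
qed

lemma clockwise_in_image_iff:
  assumes "d < n" "e < n"
  shows "clockwise n j d \<in> clockwise n j ` {..e} \<longleftrightarrow> d \<le> e"
proof
  assume "clockwise n j d \<in> clockwise n j ` {..e}"
  then obtain f where "f \<le> e" "clockwise n j d = clockwise n j f" by auto
  then show "d \<le> e" using clockwise_inj[of d n f j] assms by simp
qed auto

text \<open>The species in motion once the site at distance \<open>d\<close> has been passed: the
  running minimum of \<open>\<eta>\<close> from \<open>j\<close> on. The cascade lands exactly at
  the strict new minima.\<close>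

fun carried :: "nat \<Rightarrow> (nat \<Rightarrow> nat) \<Rightarrow> nat \<Rightarrow> nat \<Rightarrow> nat" where
  "carried n \<eta> j 0 = \<eta> j"
| "carried n \<eta> j (Suc d) = min (carried n \<eta> j d) (\<eta> (clockwise n j (Suc d)))"

lemma carried_antimono: "d \<le> e \<Longrightarrow> carried n \<eta> j e \<le> carried n \<eta> j d"
  by (induction e rule: dec_induct) (auto intro: min.coboundedI1)

lemma carried_le: "j \<in> {1..n} \<Longrightarrow> carried n \<eta> j d \<le> \<eta> (clockwise n j d)"
  by (cases d) (auto simp: clockwise_0)

text \<open>Once the cascade has landed at distance \<open>d\<close>, where the site attains the
  running minimum, the rest of it acts on the sites ahead as a sweep. The induction is on the value
  in motion, which drops at every landing.\<close>

lemma push_clockwise: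
  assumes j: "j \<in> {1..n}" and vac: "0 \<in> \<eta> ` {1..n}"
    and "d < n" "\<eta> (clockwise n j d) = carried n \<eta> j d" "e < n"
  shows "push n \<eta> (carried n \<eta> j d) (clockwise n j d) (clockwise n j e) =
    (if d < e then max (carried n \<eta> j (e - 1)) (\<eta> (clockwise n j e)) else \<eta> (clockwise n j e))"
  using assms(4-)
proof (induction "carried n \<eta> j d" arbitrary: d e rule: less_induct)
  case less
  let ?c = "carried n \<eta> j" and ?s = "clockwise n j"
  show ?case
  proof (cases "?c d = 0")
    case True
    \<comment> \<open>Nothing is smaller than 0, so the cascade stops, while the sweep carries 0 and
      changes no site.\<close>
    then have "?c (e - 1) = 0" if "d < e"
      using that carried_antimono[of d "e - 1" n \<eta> j] by simp
    then show ?thesis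
      using True by (simp add: push.simps[of n \<eta> 0])
  next
    case False
    obtain v where v: "v \<in> {1..n}" "\<eta> v = 0" using vac by (metis imageE)
    obtain D where D: "D < n" "?s D = v" using clockwise_surj[OF j v(1)] .
    \<comment> \<open>A vacancy lies ahead, before the ring closes. This guarantees that the search
      by \<open>LEAST\<close> succeeds and that the landing site is at distance
      \<open>d + m < n\<close>.\<close>
    have "d < D"
      using False carried_le[OF j, of \<eta> D] carried_antimono[of D d n \<eta> j] D v by (cases "d < D") auto
    define P where "P m \<longleftrightarrow> 1 \<le> m \<and> \<eta> (clockwise n (?s d) m) < ?c d" for m
    define m where "m = (LEAST m. P m)"
    have "P (D - d)"
      using \<open>d < D\<close> D v False by (simp add: P_def clockwise_clockwise)
    then have "P m" "m \<le> D - d"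
      unfolding m_def by (auto intro: LeastI Least_le)
    then have m: "1 \<le> m" "d + m < n" "\<eta> (?s (d + m)) < ?c d"
      using \<open>d < D\<close> D by (auto simp: P_def clockwise_clockwise)
    have skipped: "?c d \<le> \<eta> (?s f)" if "d < f" "f < d + m" for f
    proof -
      have "\<not> P (f - d)" using not_less_Least[of "f - d" P] that by (simp add: m_def)
      then show ?thesis using that by (simp add: P_def clockwise_clockwise Suc_le_eq not_less)
    qed
    have const: "?c f = ?c d" if "d \<le> f" "f < d + m" for f
      using that
    proof (induction f rule: dec_induct)
      case (step f)
      then show ?case using skipped[of "Suc f"] by simp
    qed simp
    have cm: "?c (d + m) = \<eta> (?s (d + m))"
    proof -
      obtain m' where m': "m = Suc m'" using m(1) by (cases m) auto
      show ?thesis using const[of "d + m'"] m(3) by (simp add: m')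
    qed
    have l: "next_lower n \<eta> (?c d) (?s d) = ?s (d + m)"
      by (simp add: next_lower_def m_def P_def[abs_def] clockwise_clockwise)
    have "push n \<eta> (?c d) (?s d) = (push n \<eta> (?c (d + m)) (?s (d + m)))(?s (d + m) := ?c d)"
      using m(3) by (subst push.simps) (simp add: l cm Let_def)
    moreover have "push n \<eta> (?c (d + m)) (?s (d + m)) (?s e) =
        (if d + m < e then max (?c (e - 1)) (\<eta> (?s e)) else \<eta> (?s e))"
      using m cm less.prems by (intro less.hyps) auto
    moreover have "?s e = ?s (d + m) \<longleftrightarrow> e = d + m"
      using clockwise_inj[of e n "d + m" j] m less.prems by blast
    \<comment> \<open>Sites jumped over hold at least the carried value, so the sweep leaves them
      alone. At the landing site the value just before it is still \<open>?c d\<close>, as the next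
      fact records.\<close>
    moreover have "max (?c (e - 1)) (\<eta> (?s e)) = \<eta> (?s e)" if "d < e" "e < d + m"
      using that skipped[of e] const[of "e - 1"] by simp
    moreover have "?c (d + m - 1) = ?c d"
      using const[of "d + m - 1"] m(1) by simp
    ultimately show ?thesis
      using m by (auto simp: max_def)
  qed
qed

text \<open>The cascade is a sweep begun at distance 0. A vacant ringing site fits the same formula,
  because the carried value is then 0 throughout.\<close>

lemma bell_clockwise:
  assumes "j \<in> {1..n}" "0 \<in> \<eta> ` {1..n}" "d < n"
  shows "bell n j \<eta> (clockwise n j d) =
    (if d = 0 then 0 else max (carried n \<eta> j (d - 1)) (\<eta> (clockwise n j d)))"
proof (cases "\<eta> j = 0")
  case True
  have "carried n \<eta> j (d - 1) = 0"
    using carried_antimono[of 0 "d - 1" n \<eta> j] True by simp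
  then show ?thesis
    using True assms by (auto simp: bell_def clockwise_0)
next
  case False
  have "clockwise n j d = j \<longleftrightarrow> d = 0"
    using clockwise_inj[of d n 0 j] assms clockwise_0[of j n] by auto
  then show ?thesis
    using False push_clockwise[of j n \<eta> 0 d] assms
    by (auto simp: bell_def clockwise_0)
qed

lemma push_outside: "n > 0 \<Longrightarrow> l \<notin> {1..n} \<Longrightarrow> push n \<eta> i j l = \<eta> l"
proof (induction n \<eta> i j rule: push.induct)
  case (1 n \<eta> i j)
  then show ?case
    using clockwise_in[of n j] by (subst push.simps) (auto simp: Let_def next_lower_def)
qed

lemma carried_vacancy:
  assumes "j \<in> {1..n}" "0 \<in> \<eta> ` {1..n}"
  shows "carried n \<eta> j (n - 1) = 0"
proof -
  obtain v where "v \<in> {1..n}" "\<eta> v = 0" using assms(2) by (metis imageE)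
  moreover from this obtain d where "d < n" "clockwise n j d = v"
    using clockwise_surj assms(1) by metis
  ultimately show ?thesis
    using carried_le[OF assms(1), of \<eta> d] carried_antimono[of d "n - 1" n \<eta> j] assms by simp
qed

text \<open>Each step of the sweep exchanges the carried value, stored at \<open>j\<close>, with the site passed
  if the latter is smaller.\<close>

lemma sweep_permutation:
  assumes "j \<in> {1..n}" "d < n"
  shows "\<exists>p. p permutes {1..n} \<and> (\<forall>e<n. \<eta> (p (clockwise n j e)) =
    (if e = 0 then carried n \<eta> j d
     else if e \<le> d then max (carried n \<eta> j (e - 1)) (\<eta> (clockwise n j e))
     else \<eta> (clockwise n j e)))"
  using assms(2)
proof (induction d)
  case 0
  then show ?case using assms by (intro exI[of _ id] conjI permutes_id) (auto simp: clockwise_0)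
next
  case (Suc d)
  let ?s = "clockwise n j"
  obtain p where p: "p permutes {1..n}" and val: "\<And>e. e < n \<Longrightarrow> \<eta> (p (?s e)) =
    (if e = 0 then carried n \<eta> j d
     else if e \<le> d then max (carried n \<eta> j (e - 1)) (\<eta> (?s e)) else \<eta> (?s e))"
    using Suc by auto
  show ?case
  proof (cases "\<eta> (?s (Suc d)) < carried n \<eta> j d")
    case False
    then show ?thesis using p val by (intro exI[of _ p]) (auto simp: le_Suc_eq)
  next
    case True
    let ?t = "Transposition.transpose j (?s (Suc d))"
    have "?t permutes {1..n}"
      using assms clockwise_in[of n j "Suc d"] by (intro permutes_swap_id) auto
    moreover have "?t (?s e) = (if e = 0 then ?s (Suc d) else if e = Suc d then ?s 0 else ?s e)"
      if "e < n" for e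
    proof -
      have "?s e = j \<longleftrightarrow> e = 0" "?s e = ?s (Suc d) \<longleftrightarrow> e = Suc d"
        using clockwise_inj[of e n 0 j] clockwise_inj[of e n "Suc d" j] that Suc.prems
          clockwise_0[OF assms(1)] by auto
      then show ?thesis
        using clockwise_0[OF assms(1)] by (auto simp: Transposition.transpose_def)
    qed
    ultimately show ?thesis
      using p val True Suc.prems
      by (intro exI[of _ "p \<circ> ?t"] conjI permutes_compose) (auto simp: le_Suc_eq)
  qed
qed

text \<open>After a full turn the sweep carries 0, thanks to the vacancy. Storing this value at
  \<open>j\<close> agrees with the vacancy that the bell leaves there, so the bell only rearranges
  contents.\<close>

lemma bell_permutation:
  assumes "j \<in> {1..n}" "0 \<in> \<eta> ` {1..n}"
  shows "\<exists>p. p permutes {1..n} \<and> bell n j \<eta> = \<eta> \<circ> p"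
proof -
  have n: "n - 1 < n" using assms by auto
  obtain p where p: "p permutes {1..n}" and val: "\<And>e. e < n \<Longrightarrow> \<eta> (p (clockwise n j e)) =
    (if e = 0 then carried n \<eta> j (n - 1)
     else if e \<le> n - 1 then max (carried n \<eta> j (e - 1)) (\<eta> (clockwise n j e))
     else \<eta> (clockwise n j e))"
    using sweep_permutation[OF assms(1) n] by metis
  have "bell n j \<eta> l = \<eta> (p l)" for l
  proof (cases "l \<in> {1..n}")
    case True
    then obtain e where "e < n" "clockwise n j e = l" using clockwise_surj assms(1) by metis
    then show ?thesis
      using val[of e] bell_clockwise[of j n \<eta> e] assms carried_vacancy[of j n \<eta>] by auto
  next
    case False
    then show ?thesis
      using assms push_outside[of n l \<eta>] permutes_not_in[OF p False] by (auto simp: bell_def)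
  qed
  then show ?thesis using p by (auto simp: fun_eq_iff)
qed

section \<open>Bells preserve the content\<close>

lemma configs_permute:
  assumes "\<eta> \<in> configs n s m" "p permutes {1..n}"
  shows "\<eta> \<circ> p \<in> configs n s m"
proof -
  have "card {j \<in> {1..n}. \<eta> (p j) = r} = card {j \<in> {1..n}. \<eta> j = r}" for r
  proof (rule bij_betw_same_card[of p])
    show "bij_betw p {j \<in> {1..n}. \<eta> (p j) = r} {j \<in> {1..n}. \<eta> j = r}"
      unfolding bij_betw_def
    proof
      show "inj_on p {j \<in> {1..n}. \<eta> (p j) = r}"
        using permutes_inj_on[OF assms(2)] .
      have "p (inv p y) = y" "inv p y \<in> {1..n} \<longleftrightarrow> y \<in> {1..n}" "p y \<in> {1..n} \<longleftrightarrow> y \<in> {1..n}" for y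
        using permutes_inverses[OF assms(2)] permutes_in_image[OF permutes_inv[OF assms(2)]]
          permutes_in_image[OF assms(2)] by auto
      then show "p ` {j \<in> {1..n}. \<eta> (p j) = r} = {j \<in> {1..n}. \<eta> j = r}"
        by (intro equalityI subsetI image_eqI[of _ p "inv p _"]) auto
    qed
  qed
  moreover have "\<eta> \<circ> p \<in> {1..n} \<rightarrow>\<^sub>E {0..s}"
    using assms permutes_in_image[OF assms(2)] permutes_not_in[OF assms(2)]
    by (auto simp: configs_def PiE_iff extensional_def)
  ultimately show ?thesis using assms by (simp add: configs_def)
qed

lemma configs_vacancy:
  assumes "\<eta> \<in> configs n s m" "m 0 \<ge> 1"
  shows "0 \<in> \<eta> ` {1..n}"
proof -
  have "card {j \<in> {1..n}. \<eta> j = 0} \<noteq> 0" using assms by (auto simp: configs_def)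
  then have "{j \<in> {1..n}. \<eta> j = 0} \<noteq> {}" by (metis card.empty)
  then show ?thesis by force
qed

lemma bell_in_configs:
  assumes "\<eta> \<in> configs n s m" "m 0 \<ge> 1" "j \<in> {1..n}"
  shows "bell n j \<eta> \<in> configs n s m"
proof -
  obtain p where "p permutes {1..n}" "bell n j \<eta> = \<eta> \<circ> p"
    using bell_permutation[OF assms(3) configs_vacancy[OF assms(1,2)]] by blast
  then show ?thesis using configs_permute[OF assms(1)] by simp
qed

lemma configs_eqI:
  assumes "\<eta> \<in> configs n s m" "\<zeta> \<in> configs n s m'" "\<And>l. l \<in> {1..n} \<Longrightarrow> \<eta> l = \<zeta> l"
  shows "\<eta> = \<zeta>"
  by (rule PiE_ext[of \<eta> "{1..n}" "\<lambda>_. {0..s}" \<zeta>]) (use assms in \<open>auto simp: configs_def\<close>)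

lemma finite_configs: "finite (configs n s m)"
  by (rule finite_subset[of _ "{1..n} \<rightarrow>\<^sub>E {0..s}"]) (auto simp: configs_def intro: finite_PiE)


section \<open>The generator as a sum over ringing sites\<close>

lemma sum_pushtasep_rate:
  assumes "finite S" "\<And>j. j \<in> {1..n} \<Longrightarrow> bell n j a \<in> S"
  shows "(\<Sum>b\<in>S. pushtasep_rate n x a b * f b) = (\<Sum>j=1..n. 1 / x j * f (bell n j a))"
proof -
  have "(\<Sum>b\<in>S. pushtasep_rate n x a b * f b)
      = (\<Sum>b\<in>S. \<Sum>j=1..n. if b = bell n j a then 1 / x j * f b else 0)"
  proof (intro sum.cong refl)
    fix b
    have "pushtasep_rate n x a b = (\<Sum>j=1..n. if b = bell n j a then 1 / x j else 0)"
      unfolding pushtasep_rate_def by (subst sum.inter_filter[symmetric]) (auto intro!: sum.cong)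
    then show "pushtasep_rate n x a b * f b = (\<Sum>j=1..n. if b = bell n j a then 1 / x j * f b else 0)"
      by (auto simp: sum_distrib_right intro!: sum.cong)
  qed
  also have "\<dots> = (\<Sum>j=1..n. \<Sum>b\<in>S. if b = bell n j a then 1 / x j * f b else 0)"
    by (rule sum.swap)
  also have "\<dots> = (\<Sum>j=1..n. 1 / x j * f (bell n j a))"
    using assms by (intro sum.cong) auto
  finally show ?thesis .
qed

lemma sum_generator_pushtasep:
  assumes "finite S" "a \<in> S" "\<And>j. j \<in> {1..n} \<Longrightarrow> bell n j a \<in> S"
  shows "(\<Sum>b\<in>S. generator S (pushtasep_rate n x) a b * f b)
       = (\<Sum>j=1..n. 1 / x j * (f (bell n j a) - f a))"
  using assms sum_pushtasep_rate[OF assms(1,3), of x "\<lambda>b. f b - f a"]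
  by (simp add: sum_generator_row)

section \<open>Exchanging the parameters of two adjacent sites\<close>

lemma carried_eq_Min: "j \<in> {1..n} \<Longrightarrow> carried n \<eta> j d = Min (\<eta> ` clockwise n j ` {..d})"
  by (induction d) (simp_all add: clockwise_0 atMost_Suc min.commute)

lemma carried_Suc_shift:
  assumes "j \<in> {1..n}"
  shows "carried n \<eta> j (Suc d) = min (\<eta> j) (carried n \<eta> (clockwise n j 1) d)"
proof (induction d)
  case (Suc d)
  have "carried n \<eta> j (Suc (Suc d)) = min (carried n \<eta> j (Suc d)) (\<eta> (clockwise n j (Suc (Suc d))))"
    by simp
  then show ?case using Suc.IH by (simp add: clockwise_clockwise min.assoc)
qed simp

text \<open>The running minimum depends only on the set of values met. If both or neither of
  \<open>u\<close> and \<open>v\<close> have been passed, the exchange does not alter that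
  set.\<close>

lemma carried_transpose:
  assumes "j \<in> {1..n}" "u \<in> clockwise n j ` {..d} \<longleftrightarrow> v \<in> clockwise n j ` {..d}"
  shows "carried n (\<eta> \<circ> Transposition.transpose u v) j d = carried n \<eta> j d"
proof -
  let ?X = "clockwise n j ` {..d}"
  have "(\<eta> \<circ> Transposition.transpose u v) ` ?X = \<eta> ` (Transposition.transpose u v ` ?X)"
    by (rule image_comp[symmetric])
  also have "Transposition.transpose u v ` ?X = ?X"
    using assms(2) by (rule transpose_image_eq)
  finally show ?thesis using assms(1) by (simp only: carried_eq_Min)
qed

text \<open>The sweep from \<open>i\<close> meets \<open>Suc i\<close> first: the larger of the two
  values stays there, the smaller goes on, and \<open>i\<close> becomes vacant. This is symmetric in
  the two values.\<close>

lemma bell_transpose_same_site: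
  assumes i: "i \<in> {1..<n}" and v: "0 \<in> \<eta> ` {1..n}" and v': "0 \<in> (\<eta> \<circ> Transposition.transpose i (Suc i)) ` {1..n}"
  shows "bell n i (\<eta> \<circ> Transposition.transpose i (Suc i)) l = bell n i \<eta> l"
proof (cases "l \<in> {1..n}")
  case True
  let ?t = "Transposition.transpose i (Suc i)"
  have i': "i \<in> {1..n}" using i by auto
  obtain d where d: "d < n" "clockwise n i d = l" using clockwise_surj[OF i' True] .
  have s0: "clockwise n i 0 = i" using clockwise_0[OF i'] .
  have s1: "clockwise n i 1 = Suc i" using clockwise_Suc[of n i 0] s0 i by simp
  consider "d = 0" | "d = 1" | e where "d = Suc (Suc e)" by (metis One_nat_def not0_implies_Suc)
  then show ?thesis
  proof cases
    case 1
    then show ?thesis using bell_clockwise[OF i' v d(1)] bell_clockwise[OF i' v' d(1)] d by simp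
  next
    case 2
    then show ?thesis using bell_clockwise[OF i' v d(1)] bell_clockwise[OF i' v' d(1)] d s1
      by (simp add: max.commute)
  next
    case (3 e)
    have "i \<in> clockwise n i ` {..Suc e}" "Suc i \<in> clockwise n i ` {..Suc e}"
      using s0 s1 by (metis atMost_iff image_eqI le0, metis One_nat_def Suc_le_mono atMost_iff image_eqI le0)
    then have "carried n (\<eta> \<circ> ?t) i (Suc e) = carried n \<eta> i (Suc e)"
      by (intro carried_transpose i') simp
    moreover have "clockwise n i d \<noteq> i" "clockwise n i d \<noteq> Suc i"
      using clockwise_inj[of d n 0 i] clockwise_inj[of d n 1 i] d 3 s0 s1 i by auto
    ultimately show ?thesis
      using bell_clockwise[OF i' v d(1)] bell_clockwise[OF i' v' d(1)] d 3
      by simp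
  qed
next
  case False
  then show ?thesis
    using i push_outside[of n l] by (auto simp: bell_def)
qed

text \<open>When \<open>i\<close> rings, its content settles at \<open>Suc i\<close> and the smaller
  \<open>\<eta> (Suc i)\<close> travels on exactly as if \<open>Suc i\<close> had rung. When
  \<open>Suc i\<close> rings, the sweep ends at \<open>i\<close> with too small a value to displace
  \<open>\<eta> i\<close>. The two results differ only in which of the two sites holds
  \<open>\<eta> i\<close> and which is vacant.\<close>

lemma bell_adjacent_sites:
  assumes i: "i \<in> {1..<n}" and v: "0 \<in> \<eta> ` {1..n}" and le: "\<eta> (Suc i) \<le> \<eta> i"
  shows "bell n i \<eta> l = bell n (Suc i) \<eta> (Transposition.transpose i (Suc i) l)"
proof (cases "l \<in> {1..n}")
  case True
  have i': "i \<in> {1..n}" "Suc i \<in> {1..n}" using i by auto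
  obtain d where d: "d < n" "clockwise n i d = l" using clockwise_surj[OF i'(1) True] .
  have s0: "clockwise n i 0 = i" using clockwise_0[OF i'(1)] .
  have s1: "clockwise n i 1 = Suc i" using clockwise_Suc[of n i 0] s0 i by simp
  have s: "clockwise n (Suc i) e = clockwise n i (Suc e)" for e
    by (simp flip: s1 add: clockwise_clockwise)
  have at_i: "bell n i \<eta> i = 0" "bell n i \<eta> (Suc i) = \<eta> i"
    using bell_clockwise[OF i'(1) v, of 0] bell_clockwise[OF i'(1) v, of 1] s0 s1 i le by auto
  \<comment> \<open>Site \<open>i\<close> is the last one on the sweep from \<open>Suc i\<close>, at
    distance \<open>n - 1\<close>, so the value reaching it is the one carried at distance
    \<open>n - 1 - 1\<close>.\<close>
  have "clockwise n (Suc i) (n - 1) = i"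
    using i clockwise_n[OF i'(1)] by (simp add: s)
  moreover have "carried n \<eta> (Suc i) (n - 1 - 1) \<le> \<eta> i"
    using carried_antimono[of 0 "n - 1 - 1" n \<eta> "Suc i"] le by simp
  ultimately have at_Suc: "bell n (Suc i) \<eta> (Suc i) = 0" "bell n (Suc i) \<eta> i = \<eta> i"
    using bell_clockwise[OF i'(2) v, of 0] bell_clockwise[OF i'(2) v, of "n - 1"]
      clockwise_0[OF i'(2)] i by auto
  consider "d = 0" | "d = 1" | e where "d = Suc (Suc e)" by (metis One_nat_def not0_implies_Suc)
  then show ?thesis
  proof cases
    case (3 e)
    have "clockwise n i d \<noteq> i" "clockwise n i d \<noteq> Suc i"
      using clockwise_inj[of d n 0 i] clockwise_inj[of d n 1 i] d 3 s0 s1 i by auto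
    moreover have "carried n \<eta> i (Suc e) = carried n \<eta> (Suc i) e"
      using carried_Suc_shift[OF i'(1), of \<eta> e] s1 carried_antimono[of 0 e n \<eta> "Suc i"] le by simp
    ultimately show ?thesis
      using bell_clockwise[OF i'(1) v d(1)] bell_clockwise[OF i'(2) v, of "Suc e"] d 3 s[of "Suc e"]
      by simp
  qed (use d s0 s1 at_i at_Suc in simp_all)
next
  case False
  then have "l \<noteq> i" "l \<noteq> Suc i" using i by auto
  then show ?thesis
    using False i push_outside[of n l \<eta>] by (auto simp: bell_def)
qed

text \<open>A sweep arriving with value \<open>c\<close> passes \<open>i\<close> and then
  \<open>Suc i\<close>, and leaves with the minimum of \<open>c\<close> and both contents, whatever
  their order. If \<open>\<eta> i < \<eta> (Suc i)\<close>, two cases arise: for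
  \<open>c \<ge> \<eta> (Suc i)\<close> both orders end in the same decreasing pair, and for smaller
  \<open>c\<close> the two outcomes are exchanges of each other.\<close>

lemma bell_other_site:
  assumes i: "i \<in> {1..<n}" and j: "j \<in> {1..n}" "j \<noteq> i" "j \<noteq> Suc i"
    and v: "0 \<in> \<eta> ` {1..n}"
    and v': "0 \<in> (\<eta> \<circ> Transposition.transpose i (Suc i)) ` {1..n}"
  shows "\<eta> (Suc i) \<le> \<eta> i \<Longrightarrow> bell n j \<eta> (Suc i) \<le> bell n j \<eta> i"
    and "\<eta> i < \<eta> (Suc i) \<Longrightarrow> bell n j (\<eta> \<circ> Transposition.transpose i (Suc i)) l =
      (if bell n j \<eta> (Suc i) \<le> bell n j \<eta> i then bell n j \<eta> l
       else bell n j \<eta> (Transposition.transpose i (Suc i) l))"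
proof -
  let ?t = "Transposition.transpose i (Suc i)" and ?s = "clockwise n j"
  have i': "i \<in> {1..n}" "Suc i \<in> {1..n}" using i by auto
  obtain d where d: "d < n" "?s d = i" using clockwise_surj[OF j(1) i'(1)] .
  have d0: "d \<noteq> 0" using d(2) j(2) clockwise_0[OF j(1)] by metis
  then obtain d' where d': "d = Suc d'" by (cases d) auto
  have sS: "?s (Suc d) = Suc i" using clockwise_Suc[of n j d] d i by simp
  \<comment> \<open>The start \<open>j\<close> is not \<open>Suc i\<close>, so the sweep does not
    close between \<open>i\<close> and \<open>Suc i\<close>.\<close>
  have "Suc d < n"
  proof (rule ccontr)
    assume "\<not> Suc d < n"
    then have "Suc d = n" using d by simp
    then show False using sS j clockwise_n[OF j(1)] by simp
  qed
  have at: "bell n j \<eta> i = max (carried n \<eta> j d') (\<eta> i)"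
    "bell n j \<eta> (Suc i) = max (min (carried n \<eta> j d') (\<eta> i)) (\<eta> (Suc i))"
    using bell_clockwise[OF j(1) v d(1)] bell_clockwise[OF j(1) v \<open>Suc d < n\<close>] d d' sS by auto
  show "bell n j \<eta> (Suc i) \<le> bell n j \<eta> i" if "\<eta> (Suc i) \<le> \<eta> i"
    using that by (auto simp: at min_le_iff_disj le_max_iff_disj)
  assume less: "\<eta> i < \<eta> (Suc i)"
  \<comment> \<open>Only at distance \<open>d\<close> has exactly one of the two sites been
    passed.\<close>
  have carried: "carried n (\<eta> \<circ> ?t) j e = carried n \<eta> j e" if "e < n" "e \<noteq> d" for e
  proof (rule carried_transpose[OF j(1)])
    have "i \<in> ?s ` {..e} \<longleftrightarrow> d \<le> e" "Suc i \<in> ?s ` {..e} \<longleftrightarrow> Suc d \<le> e"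
      using clockwise_in_image_iff[OF d(1) \<open>e < n\<close>, of j]
        clockwise_in_image_iff[OF \<open>Suc d < n\<close> \<open>e < n\<close>, of j] d sS by auto
    then show "i \<in> ?s ` {..e} \<longleftrightarrow> Suc i \<in> ?s ` {..e}" using that by auto
  qed
  have at': "bell n j (\<eta> \<circ> ?t) i = max (carried n \<eta> j d') (\<eta> (Suc i))"
    "bell n j (\<eta> \<circ> ?t) (Suc i) = max (min (carried n \<eta> j d') (\<eta> (Suc i))) (\<eta> i)"
    using bell_clockwise[OF j(1) v' d(1)] bell_clockwise[OF j(1) v' \<open>Suc d < n\<close>] d d' sS
      carried[of d'] by auto
  show "bell n j (\<eta> \<circ> ?t) l =
      (if bell n j \<eta> (Suc i) \<le> bell n j \<eta> i then bell n j \<eta> l else bell n j \<eta> (?t l))"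
  proof (cases "l = i \<or> l = Suc i")
    case True
    then show ?thesis using less by (auto simp: at at')
  next
    case other: False
    have "bell n j (\<eta> \<circ> ?t) l = bell n j \<eta> l"
    proof (cases "l \<in> {1..n}")
      case True
      then obtain e where e: "e < n" "?s e = l" using clockwise_surj[OF j(1)] by metis
      have "e - 1 \<noteq> d" if "e \<noteq> 0"
      proof
        assume "e - 1 = d"
        then have "e = Suc d" using that by simp
        then show False using e sS other by simp
      qed
      then show ?thesis
        using bell_clockwise[OF j(1) v e(1)] bell_clockwise[OF j(1) v' e(1)] e other carried[of "e - 1"]
        by simp
    next
      case False
      then show ?thesis
        using other j push_outside[of n l] by (auto simp: bell_def)
    qed
    then show ?thesis using other by simp
  qed
qed


text \<open>The weight \<open>\<beta>\<close> will be a ratio of two parameters, so \<open>1 - \<beta>\<close> can be negative: the kernel is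
  only a signed one.\<close>

definition swap_op :: "real \<Rightarrow> nat \<Rightarrow> ((nat \<Rightarrow> nat) \<Rightarrow> real) \<Rightarrow> (nat \<Rightarrow> nat) \<Rightarrow> real" where
  "swap_op \<beta> i f \<eta> =
     (if \<eta> (Suc i) \<le> \<eta> i then f \<eta>
      else \<beta> * f \<eta> + (1 - \<beta>) * f (\<eta> \<circ> Transposition.transpose i (Suc i)))"

text \<open>If both sites are vacant, the exchange does nothing and the two branches of
  \<open>swap_op\<close> agree. This evaluates \<open>swap_op\<close> after a bell at
  \<open>i\<close> without a case split.\<close>

lemma swap_op_vacancy:
  assumes "\<eta> i = 0"
  shows "swap_op \<beta> i f \<eta> = \<beta> * f \<eta> + (1 - \<beta>) * f (\<eta> \<circ> Transposition.transpose i (Suc i))"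
proof (cases "\<eta> (Suc i) = 0")
  case True
  then have "\<eta> \<circ> Transposition.transpose i (Suc i) = \<eta>"
    using assms by (auto simp: fun_eq_iff Transposition.transpose_def)
  then show ?thesis using True by (simp add: swap_op_def algebra_simps)
qed (use assms in \<open>simp add: swap_op_def\<close>)

lemma swap_op_diff:
  "r * (swap_op \<beta> i g \<eta> - swap_op \<beta> i f \<eta>) = swap_op \<beta> i (\<lambda>\<zeta>. r * (g \<zeta> - f \<zeta>)) \<eta>"
  by (simp add: swap_op_def algebra_simps)

lemma swap_op_sum:
  "(\<Sum>j\<in>J. swap_op \<beta> i (g j) \<eta>) = swap_op \<beta> i (\<lambda>\<zeta>. \<Sum>j\<in>J. g j \<zeta>) \<eta>"
  by (simp add: swap_op_def sum.distrib sum_distrib_left)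

text \<open>The values of the operator on indicators are its matrix entries; summing them against
  \<open>f\<close> recovers the operator.\<close>

lemma sum_swap_op_of_bool:
  assumes "finite S" "\<eta> \<in> S" "\<eta> \<circ> Transposition.transpose i (Suc i) \<in> S"
  shows "(\<Sum>\<zeta>\<in>S. swap_op \<beta> i (\<lambda>\<xi>. of_bool (\<xi> = \<zeta>)) \<eta> * f \<zeta>) = swap_op \<beta> i f \<eta>"
proof -
  have "(\<Sum>\<zeta>\<in>S. of_bool (\<xi> = \<zeta>) * f \<zeta>) = f \<xi>" if "\<xi> \<in> S" for \<xi>
  proof -
    have "(\<Sum>\<zeta>\<in>S. of_bool (\<xi> = \<zeta>) * f \<zeta>) = (\<Sum>\<zeta>\<in>S. if \<xi> = \<zeta> then f \<zeta> else 0)"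
      by (intro sum.cong) auto
    then show ?thesis using that assms(1) by simp
  qed
  then show ?thesis
    using assms by (simp add: swap_op_def distrib_right sum.distrib mult.assoc sum_distrib_left[symmetric])
qed

text \<open>Bells away from the two sites commute with the operator. When such a bell sorts an
  increasing pair, both terms of the mixture take the same value and the weights add up to
  1.\<close>

lemma swap_op_bell_other:
  assumes i: "i \<in> {1..<n}" and j: "j \<in> {1..n}" "j \<noteq> i" "j \<noteq> Suc i"
    and v: "0 \<in> \<eta> ` {1..n}" and v': "0 \<in> (\<eta> \<circ> Transposition.transpose i (Suc i)) ` {1..n}"
  shows "swap_op \<beta> i f (bell n j \<eta>) = swap_op \<beta> i (\<lambda>\<zeta>. f (bell n j \<zeta>)) \<eta>"
proof (cases "\<eta> (Suc i) \<le> \<eta> i")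
  case True
  then show ?thesis using bell_other_site(1)[OF assms] by (simp add: swap_op_def)
next
  case False
  let ?t = "Transposition.transpose i (Suc i)"
  have "bell n j (\<eta> \<circ> ?t) = (if bell n j \<eta> (Suc i) \<le> bell n j \<eta> i then bell n j \<eta> else bell n j \<eta> \<circ> ?t)"
    using bell_other_site(2)[OF assms] False by (auto simp: fun_eq_iff)
  then show ?thesis using False by (simp add: swap_op_def algebra_simps)
qed

text \<open>This is \<open>Q K = K Q'\<close> applied to a function \<open>f\<close>. The other
  bells commute with the operator, which leaves an identity between the bells at \<open>i\<close>
  and \<open>Suc i\<close> with their rates exchanged.\<close>

lemma swap_op_bells:
  assumes i: "i \<in> {1..<n}" and pos: "x i > 0" "x (Suc i) > 0"
    and v: "0 \<in> \<eta> ` {1..n}" and v': "0 \<in> (\<eta> \<circ> Transposition.transpose i (Suc i)) ` {1..n}"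
  defines "\<beta> \<equiv> x i / x (Suc i)"
  shows "(\<Sum>j=1..n. 1 / x j * (swap_op \<beta> i f (bell n j \<eta>) - swap_op \<beta> i f \<eta>)) =
    swap_op \<beta> i (\<lambda>\<zeta>. \<Sum>j=1..n. 1 / (x \<circ> Transposition.transpose i (Suc i)) j * (f (bell n j \<zeta>) - f \<zeta>)) \<eta>"
proof -
  let ?t = "Transposition.transpose i (Suc i)" and ?J = "{1..n} - {i} - {Suc i}"
  have split: "(\<Sum>j=1..n. g j) = g i + (g (Suc i) + (\<Sum>j\<in>?J. g j))" for g :: "nat \<Rightarrow> real"
    using i by (subst sum.remove[of _ i], simp, simp, subst sum.remove[of _ "Suc i"]) auto
  define u v where "u = 1 / x i" and "v = 1 / x (Suc i)"
  \<comment> \<open>This relation determines the weight: on a decreasing pair,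
    \<open>f (bell n i \<eta>)\<close> has coefficient \<open>u * \<beta>\<close> on the left and
    the exchanged rate \<open>v\<close> on the right.\<close>
  have \<beta>: "u * \<beta> = v" using pos by (simp add: u_def v_def \<beta>_def)
  define F where "F \<zeta> = (\<Sum>j\<in>?J. 1 / x j * (f (bell n j \<zeta>) - f \<zeta>))" for \<zeta>
  have "(\<Sum>j\<in>?J. 1 / x j * (swap_op \<beta> i f (bell n j \<eta>) - swap_op \<beta> i f \<eta>))
      = (\<Sum>j\<in>?J. 1 / x j * (swap_op \<beta> i (\<lambda>\<zeta>. f (bell n j \<zeta>)) \<eta> - swap_op \<beta> i f \<eta>))"
    using swap_op_bell_other[OF i _ _ _ assms(4) v'] by (intro sum.cong) auto
  also have "\<dots> = swap_op \<beta> i F \<eta>"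
    unfolding swap_op_diff swap_op_sum F_def ..
  finally have other: "(\<Sum>j\<in>?J. 1 / x j * (swap_op \<beta> i f (bell n j \<eta>) - swap_op \<beta> i f \<eta>)) = swap_op \<beta> i F \<eta>" .
  have "(\<Sum>j\<in>?J. 1 / (x \<circ> ?t) j * (f (bell n j \<zeta>) - f \<zeta>)) = F \<zeta>" for \<zeta>
    unfolding F_def by (intro sum.cong) (auto simp: Transposition.transpose_def)
  then have rhs: "swap_op \<beta> i (\<lambda>\<zeta>. \<Sum>j=1..n. 1 / (x \<circ> ?t) j * (f (bell n j \<zeta>) - f \<zeta>)) \<eta>
      = swap_op \<beta> i (\<lambda>\<zeta>. v * (f (bell n i \<zeta>) - f \<zeta>) + (u * (f (bell n (Suc i) \<zeta>) - f \<zeta>) + F \<zeta>)) \<eta>"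
    unfolding split by (simp add: u_def v_def)
  have bell_0: "bell n j \<zeta> j = 0" for j \<zeta> by (simp add: bell_def)
  have swap_0: "swap_op \<beta> i f (bell n i \<eta>) = \<beta> * f (bell n i \<eta>) + (1 - \<beta>) * f (bell n i \<eta> \<circ> ?t)"
    by (rule swap_op_vacancy) (rule bell_0)
  have swap_Suc: "swap_op \<beta> i f (bell n (Suc i) \<eta>) = f (bell n (Suc i) \<eta>)"
    by (simp add: swap_op_def bell_0)
  have local: "u * (swap_op \<beta> i f (bell n i \<eta>) - swap_op \<beta> i f \<eta>)
      + (v * (swap_op \<beta> i f (bell n (Suc i) \<eta>) - swap_op \<beta> i f \<eta>) + swap_op \<beta> i F \<eta>)
    = swap_op \<beta> i (\<lambda>\<zeta>. v * (f (bell n i \<zeta>) - f \<zeta>) + (u * (f (bell n (Suc i) \<zeta>) - f \<zeta>) + F \<zeta>)) \<eta>"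
  proof (cases "\<eta> (Suc i) \<le> \<eta> i")
    case True
    have "bell n i \<eta> = bell n (Suc i) \<eta> \<circ> ?t"
      using bell_adjacent_sites[OF i assms(4) True] by auto
    then have "bell n i \<eta> \<circ> ?t = bell n (Suc i) \<eta>"
      by (simp add: comp_assoc)
    then show ?thesis
      using True unfolding swap_0 swap_Suc \<beta>[symmetric] by (simp add: swap_op_def algebra_simps)
  next
    case False
    have same: "bell n i (\<eta> \<circ> ?t) = bell n i \<eta>"
      using bell_transpose_same_site[OF i assms(4) v'] by auto
    have "bell n i (\<eta> \<circ> ?t) = bell n (Suc i) (\<eta> \<circ> ?t) \<circ> ?t"
      using bell_adjacent_sites[OF i v'] False by auto
    then have "bell n (Suc i) (\<eta> \<circ> ?t) = bell n i \<eta> \<circ> ?t"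
      by (simp add: same comp_assoc)
    then show ?thesis
      using False unfolding swap_0 swap_Suc \<beta>[symmetric]
      by (simp add: swap_op_def same algebra_simps)
  qed
  show ?thesis
    unfolding rhs local[symmetric] split[of "\<lambda>j. 1 / x j * _ j"] other by (simp add: u_def v_def)
qed

section \<open>Permuting the parameters of the unobserved sites\<close>

text \<open>Everything the theorem needs of a kernel, bundled into a relation between parameters
  that survives composition. Row sums 1 let the kernel be summed away at the final time, and the
  last clause serves the deterministic start.\<close>

definition hidden_change ::
  "nat \<Rightarrow> nat \<Rightarrow> (nat \<Rightarrow> nat) \<Rightarrow> nat \<Rightarrow> (nat \<Rightarrow> real) \<Rightarrow> (nat \<Rightarrow> real)
    \<Rightarrow> ((nat \<Rightarrow> nat) \<Rightarrow> (nat \<Rightarrow> nat) \<Rightarrow> real) \<Rightarrow> bool" where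
  "hidden_change n s m k x x' K \<longleftrightarrow>
     intertwines (configs n s m) K (pushtasep_rate n x) (pushtasep_rate n x') \<and>
     (\<forall>\<eta>\<in>configs n s m. (\<Sum>\<zeta>\<in>configs n s m. K \<eta> \<zeta>) = 1) \<and>
     (\<forall>\<eta>\<in>configs n s m. \<forall>\<zeta>\<in>configs n s m. K \<eta> \<zeta> \<noteq> 0 \<longrightarrow> restrict \<eta> {1..k} = restrict \<zeta> {1..k}) \<and>
     (\<forall>\<eta>\<in>configs n s m. (\<forall>j\<in>{k+1..<n}. \<eta> j \<ge> \<eta> (j + 1)) \<longrightarrow>
        (\<forall>\<zeta>\<in>configs n s m. K \<eta> \<zeta> = of_bool (\<zeta> = \<eta>)))"

lemma hidden_change_refl: "hidden_change n s m k x x (\<lambda>\<eta> \<zeta>. of_bool (\<zeta> = \<eta>))"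
proof -
  have "(\<Sum>\<zeta>\<in>configs n s m. f \<zeta> * of_bool (\<xi> = \<zeta>)) = f \<xi>"
    "(\<Sum>\<zeta>\<in>configs n s m. of_bool (\<zeta> = \<xi>) * f \<zeta>) = f \<xi>"
    "(\<Sum>\<zeta>\<in>configs n s m. of_bool (\<zeta> = \<xi>)) = (1 :: real)"
    if "\<xi> \<in> configs n s m" for f :: "(nat \<Rightarrow> nat) \<Rightarrow> real" and \<xi>
  proof -
    have "f \<zeta> * of_bool (\<xi> = \<zeta>) = (if \<xi> = \<zeta> then f \<zeta> else 0)"
      "of_bool (\<zeta> = \<xi>) * f \<zeta> = (if \<zeta> = \<xi> then f \<zeta> else 0)"
      "(of_bool (\<zeta> = \<xi>) :: real) = (if \<zeta> = \<xi> then 1 else 0)" for \<zeta>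
      by auto
    then show "(\<Sum>\<zeta>\<in>configs n s m. f \<zeta> * of_bool (\<xi> = \<zeta>)) = f \<xi>"
      "(\<Sum>\<zeta>\<in>configs n s m. of_bool (\<zeta> = \<xi>) * f \<zeta>) = f \<xi>"
      "(\<Sum>\<zeta>\<in>configs n s m. of_bool (\<zeta> = \<xi>)) = (1 :: real)"
      using that by (simp_all only: sum.delta sum.delta' finite_configs if_True)
  qed
  then show ?thesis by (simp add: hidden_change_def intertwines_def)
qed

lemma hidden_change_trans:
  assumes K: "hidden_change n s m k x x' K" and L: "hidden_change n s m k x' x'' L"
  shows "hidden_change n s m k x x'' (\<lambda>\<eta> \<zeta>. \<Sum>\<xi>\<in>configs n s m. K \<eta> \<xi> * L \<xi> \<zeta>)"
  unfolding hidden_change_def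
proof (intro conjI ballI impI)
  let ?S = "configs n s m"
  show "intertwines ?S (\<lambda>\<eta> \<zeta>. \<Sum>\<xi>\<in>?S. K \<eta> \<xi> * L \<xi> \<zeta>) (pushtasep_rate n x) (pushtasep_rate n x'')"
    using K L by (auto simp: hidden_change_def intro: intertwines_compose)
  fix \<eta> assume \<eta>: "\<eta> \<in> ?S"
  have "(\<Sum>\<zeta>\<in>?S. \<Sum>\<xi>\<in>?S. K \<eta> \<xi> * L \<xi> \<zeta>) = (\<Sum>\<xi>\<in>?S. K \<eta> \<xi> * (\<Sum>\<zeta>\<in>?S. L \<xi> \<zeta>))"
    unfolding sum_distrib_left by (rule sum.swap)
  also have "\<dots> = 1" using K L \<eta> by (simp add: hidden_change_def)
  finally show "(\<Sum>\<zeta>\<in>?S. \<Sum>\<xi>\<in>?S. K \<eta> \<xi> * L \<xi> \<zeta>) = 1" .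
  fix \<zeta> assume \<zeta>: "\<zeta> \<in> ?S"
  show "restrict \<eta> {1..k} = restrict \<zeta> {1..k}" if nz: "(\<Sum>\<xi>\<in>?S. K \<eta> \<xi> * L \<xi> \<zeta>) \<noteq> 0"
  proof -
    obtain \<xi> where "\<xi> \<in> ?S" "K \<eta> \<xi> * L \<xi> \<zeta> \<noteq> 0" 
      using sum.not_neutral_contains_not_neutral[OF nz] by blast
    moreover from this have "K \<eta> \<xi> \<noteq> 0" "L \<xi> \<zeta> \<noteq> 0" by auto
    ultimately have "restrict \<eta> {1..k} = restrict \<xi> {1..k}" "restrict \<xi> {1..k} = restrict \<zeta> {1..k}"
      using K L \<eta> \<zeta> by (simp_all add: hidden_change_def)
    then show ?thesis by simp
  qed
  show "(\<Sum>\<xi>\<in>?S. K \<eta> \<xi> * L \<xi> \<zeta>) = of_bool (\<zeta> = \<eta>)" if "\<forall>j\<in>{k+1..<n}. \<eta> j \<ge> \<eta> (j + 1)"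
  proof -
    \<comment> \<open>The first kernel fixes \<open>\<eta>\<close>, so the product reduces to the
      row of \<open>L\<close> at the same \<open>\<eta>\<close>.\<close>
    have "K \<eta> \<xi> = of_bool (\<xi> = \<eta>)" if "\<xi> \<in> ?S" for \<xi>
      using K \<eta> that \<open>\<forall>j\<in>{k+1..<n}. \<eta> j \<ge> \<eta> (j + 1)\<close> unfolding hidden_change_def by blast
    then have "(\<Sum>\<xi>\<in>?S. K \<eta> \<xi> * L \<xi> \<zeta>) = (\<Sum>\<xi>\<in>?S. if \<xi> = \<eta> then L \<eta> \<zeta> else 0)"
      by (intro sum.cong) auto
    also have "\<dots> = L \<eta> \<zeta>" using \<eta> by (simp add: finite_configs)
    also have "\<dots> = of_bool (\<zeta> = \<eta>)"
      using L \<eta> \<zeta> that unfolding hidden_change_def by blast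
    finally show ?thesis .
  qed
qed

lemma hidden_change_adjacent:
  assumes m: "m 0 \<ge> 1" and i: "i \<in> {k+1..<n}" and pos: "\<And>j. j \<in> {1..n} \<Longrightarrow> x j > 0"
  shows "hidden_change n s m k x (x \<circ> Transposition.transpose i (Suc i))
    (\<lambda>\<eta> \<zeta>. swap_op (x i / x (Suc i)) i (\<lambda>\<xi>. of_bool (\<xi> = \<zeta>)) \<eta>)"
proof -
  let ?S = "configs n s m" and ?t = "Transposition.transpose i (Suc i)" and ?\<beta> = "x i / x (Suc i)"
  define K where "K \<eta> \<zeta> = swap_op ?\<beta> i (\<lambda>\<xi>. of_bool (\<xi> = \<zeta>)) \<eta>" for \<eta> \<zeta> :: "nat \<Rightarrow> nat"
  have i': "i \<in> {1..<n}" using i by auto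
  have swap: "\<eta> \<circ> ?t \<in> ?S" if "\<eta> \<in> ?S" for \<eta>
    using that i' by (intro configs_permute permutes_swap_id) auto
  have sum_K: "(\<Sum>\<zeta>\<in>?S. K \<eta> \<zeta> * f \<zeta>) = swap_op ?\<beta> i f \<eta>" if "\<eta> \<in> ?S" for \<eta> f
    unfolding K_def using that swap[OF that] by (rule sum_swap_op_of_bool[OF finite_configs])
  have "intertwines ?S K (pushtasep_rate n x) (pushtasep_rate n (x \<circ> ?t))"
    unfolding intertwines_def
  proof (intro ballI)
    fix \<eta> \<zeta> assume \<eta>: "\<eta> \<in> ?S" and \<zeta>: "\<zeta> \<in> ?S"
    let ?f = "\<lambda>\<xi>. of_bool (\<xi> = \<zeta>) :: real"
    \<comment> \<open>A column of the generator is the generator applied to an indicator, which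
      turns the operator identity into the matrix identity.\<close>
    have gen: "generator ?S (pushtasep_rate n (x \<circ> ?t)) \<xi> \<zeta>
        = (\<Sum>j=1..n. 1 / (x \<circ> ?t) j * (?f (bell n j \<xi>) - ?f \<xi>))" if "\<xi> \<in> ?S" for \<xi>
      using sum_generator_pushtasep[OF finite_configs that bell_in_configs[OF that m], of "x \<circ> ?t" ?f] \<zeta>
      by (simp add: finite_configs of_bool_def if_distrib[of "\<lambda>c. _ * c"] cong: if_cong)
    have "(\<Sum>\<xi>\<in>?S. generator ?S (pushtasep_rate n x) \<eta> \<xi> * K \<xi> \<zeta>)
        = (\<Sum>j=1..n. 1 / x j * (K (bell n j \<eta>) \<zeta> - K \<eta> \<zeta>))"
      using \<eta> m by (intro sum_generator_pushtasep finite_configs bell_in_configs)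
    also have "\<dots> = swap_op ?\<beta> i (\<lambda>\<xi>. \<Sum>j=1..n. 1 / (x \<circ> ?t) j * (?f (bell n j \<xi>) - ?f \<xi>)) \<eta>"
      unfolding K_def using i' pos \<eta> swap[OF \<eta>] m
      by (intro swap_op_bells configs_vacancy[where m = m]) auto
    also have "\<dots> = (\<Sum>\<xi>\<in>?S. K \<eta> \<xi> * (\<Sum>j=1..n. 1 / (x \<circ> ?t) j * (?f (bell n j \<xi>) - ?f \<xi>)))"
      using sum_K[OF \<eta>] by simp
    also have "\<dots> = (\<Sum>\<xi>\<in>?S. K \<eta> \<xi> * generator ?S (pushtasep_rate n (x \<circ> ?t)) \<xi> \<zeta>)"
      using gen by (intro sum.cong) auto
    finally show "(\<Sum>\<xi>\<in>?S. generator ?S (pushtasep_rate n x) \<eta> \<xi> * K \<xi> \<zeta>)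
        = (\<Sum>\<xi>\<in>?S. K \<eta> \<xi> * generator ?S (pushtasep_rate n (x \<circ> ?t)) \<xi> \<zeta>)" .
  qed
  moreover have "(\<Sum>\<zeta>\<in>?S. K \<eta> \<zeta>) = 1" if "\<eta> \<in> ?S" for \<eta>
    using sum_K[OF that, of "\<lambda>_. 1"] by (simp add: swap_op_def)
  moreover have "restrict \<eta> {1..k} = restrict \<zeta> {1..k}" if "K \<eta> \<zeta> \<noteq> 0" for \<eta> \<zeta>
  proof -
    have "\<zeta> = \<eta> \<or> \<zeta> = \<eta> \<circ> ?t" using that by (auto simp: K_def swap_op_def split: if_splits)
    then show ?thesis using i by (auto simp: restrict_def fun_eq_iff Transposition.transpose_def)
  qed
  moreover have "K \<eta> \<zeta> = of_bool (\<zeta> = \<eta>)" if "\<forall>j\<in>{k+1..<n}. \<eta> j \<ge> \<eta> (j + 1)" for \<eta> \<zeta>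
    using that i by (auto simp: K_def swap_op_def)
  ultimately show ?thesis unfolding K_def[abs_def, symmetric] hidden_change_def by simp
qed

text \<open>The exchange of \<open>a\<close> and \<open>Suc b\<close> is that of \<open>a\<close>
  and \<open>b\<close> conjugated by that of \<open>b\<close> and \<open>Suc b\<close>. Positivity
  is tracked through the intermediate parameters because the weights are their ratios.\<close>

lemma hidden_change_transpose:
  assumes m: "m 0 \<ge> 1" and "a \<in> {k+1..n}" "b \<in> {k+1..n}" "a < b"
    and "\<And>j. j \<in> {1..n} \<Longrightarrow> x j > 0"
  shows "\<exists>K. hidden_change n s m k x (x \<circ> Transposition.transpose a b) K"
  using assms(2-)
proof (induction b arbitrary: x)
  case (Suc b)
  let ?t = "Transposition.transpose b (Suc b)"
  have pos: "(x \<circ> Transposition.transpose u v) j > 0"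
    if "u \<in> {k+1..n}" "v \<in> {k+1..n}" "j \<in> {1..n}" "\<And>j. j \<in> {1..n} \<Longrightarrow> x j > 0" for x :: "nat \<Rightarrow> real" and u v j
    using that by (auto simp: Transposition.transpose_def)
  show ?case
  proof (cases "a = b")
    case True
    have "hidden_change n s m k x (x \<circ> ?t) (\<lambda>\<eta> \<zeta>. swap_op (x b / x (Suc b)) b (\<lambda>\<xi>. of_bool (\<xi> = \<zeta>)) \<eta>)"
      using Suc.prems True by (intro hidden_change_adjacent m) auto
    then show ?thesis unfolding True by blast
  next
    case False
    then have ab: "a < b" using Suc.prems by simp
    let ?y = "x \<circ> ?t" let ?z = "?y \<circ> Transposition.transpose a b"
    have b: "b \<in> {k+1..<n}" "b \<in> {k+1..n}" using Suc.prems ab by auto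
    have y: "?y j > 0" if "j \<in> {1..n}" for j
      using Suc.prems that b by (intro pos) auto
    have z: "?z j > 0" if "j \<in> {1..n}" for j
      using Suc.prems that b y by (intro pos) auto
    obtain K where K: "hidden_change n s m k x ?y K"
      using hidden_change_adjacent[where x = x and m = m and i = b, OF m b(1)] Suc.prems by blast
    obtain L where L: "hidden_change n s m k ?y ?z L"
      using Suc.IH[where x = ?y, OF Suc.prems(1) b(2) ab y] by blast
    obtain J where J: "hidden_change n s m k ?z (?z \<circ> ?t) J"
      using hidden_change_adjacent[where x = ?z and m = m and i = b, OF m b(1)] z by blast
    have "?t \<circ> Transposition.transpose a b \<circ> ?t = Transposition.transpose a (Suc b)"
      using ab by (auto simp: fun_eq_iff Transposition.transpose_def)
    then have eq: "?z \<circ> ?t = x \<circ> Transposition.transpose a (Suc b)"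
      by (simp only: comp_assoc)
    show ?thesis
      using hidden_change_trans[OF hidden_change_trans[OF K L] J] unfolding eq by blast
  qed
qed simp

lemma hidden_change_permutes:
  assumes m: "m 0 \<ge> 1" and \<sigma>: "\<sigma> permutes {k+1..n}"
    and pos: "\<And>j. j \<in> {1..n} \<Longrightarrow> x j > 0"
  shows "\<exists>K. hidden_change n s m k x (x \<circ> \<sigma>) K"
proof -
  \<comment> \<open>The parameters are quantified inside the induction: each transposition hands
    changed parameters to the next step.\<close>
  have "\<forall>x. (\<forall>j\<in>{1..n}. x j > 0) \<longrightarrow> (\<exists>K. hidden_change n s m k x (x \<circ> \<sigma>) K)"
    using \<sigma> finite_atLeastAtMost
  proof (induction rule: permutes_induct)
    case id
    then show ?case using hidden_change_refl by fastforce
  next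
    case (swap a b p)
    show ?case
    proof (intro allI impI)
      fix x :: "nat \<Rightarrow> real" assume x: "\<forall>j\<in>{1..n}. x j > 0"
      let ?t = "Transposition.transpose a b"
      have "\<exists>K. hidden_change n s m k x (x \<circ> ?t) K"
      proof (cases "a < b")
        case True
        then show ?thesis using swap x by (intro hidden_change_transpose[where m = m] m) auto
      next
        case False
        then show ?thesis
          unfolding transpose_commute[of a b]
          using swap x by (intro hidden_change_transpose[where m = m] m) auto
      qed
      then obtain K where K: "hidden_change n s m k x (x \<circ> ?t) K" by blast
      have "\<forall>j\<in>{1..n}. (x \<circ> ?t) j > 0"
        using x swap by (auto simp: Transposition.transpose_def)
      then obtain L where "hidden_change n s m k (x \<circ> ?t) (x \<circ> ?t \<circ> p) L"
        using swap.IH by blast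
      then show "\<exists>K. hidden_change n s m k x (x \<circ> (?t \<circ> p)) K"
        using hidden_change_trans[OF K] by (auto simp: comp_assoc)
    qed
  qed
  then show ?thesis using pos by blast
qed


section \<open>Uniqueness of the stationary distribution\<close>

fun bells :: "nat \<Rightarrow> nat \<Rightarrow> (nat \<Rightarrow> nat) \<Rightarrow> nat \<Rightarrow> nat" where
  "bells n 0 \<eta> = \<eta>"
| "bells n (Suc j) \<eta> = bell n (Suc j) (bells n j \<eta>)"

lemma bells_in_configs:
  "\<eta> \<in> configs n s m \<Longrightarrow> m 0 \<ge> 1 \<Longrightarrow> j \<le> n \<Longrightarrow> bells n j \<eta> \<in> configs n s m"
  by (induction j) (simp_all add: bell_in_configs)

text \<open>Each bell performs one pass of bubble sort, starting after the vacancy it creates.\<close>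

lemma bells_sorted:
  assumes \<eta>: "\<eta> \<in> configs n s m" and m: "m 0 \<ge> 1" and "1 \<le> j" "j \<le> n"
  shows "(\<forall>a b. 1 \<le> a \<and> a < b \<and> b \<le> j \<longrightarrow> bells n j \<eta> b \<le> bells n j \<eta> a) \<and>
    (\<forall>a b. 1 \<le> a \<and> a \<le> j \<and> j < b \<and> b \<le> n \<longrightarrow> bells n j \<eta> a \<le> bells n j \<eta> b) \<and>
    bells n j \<eta> j = 0"
  using assms(3,4)
proof (induction j rule: nat_induct_at_least)
  case base
  have 0: "bells n 1 \<eta> 1 = 0" by (simp add: bell_def)
  show ?case
  proof (intro conjI allI impI)
    fix a b :: nat
    assume "1 \<le> a \<and> a \<le> 1 \<and> 1 < b \<and> b \<le> n"
    then have "a = 1" by simp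
    then show "bells n 1 \<eta> a \<le> bells n 1 \<eta> b" by (simp only: 0 le0)
  qed (auto simp: bell_def)
next
  case (Suc j)
  let ?J = "Suc j" let ?s = "clockwise n ?J"
  define \<zeta> where "\<zeta> = bells n j \<eta>"
  have J: "?J \<in> {1..n}" "?J \<le> n" using Suc.prems by auto
  have dec: "\<zeta> b \<le> \<zeta> a" if "1 \<le> a" "a < b" "b \<le> j" for a b
    using Suc.IH Suc.prems that by (auto simp: \<zeta>_def)
  have low: "\<zeta> a \<le> \<zeta> b" if "1 \<le> a" "a \<le> j" "j < b" "b \<le> n" for a b
    using Suc.IH Suc.prems that by (auto simp: \<zeta>_def)
  have "\<zeta> \<in> configs n s m" using bells_in_configs[OF \<eta> m] Suc.prems by (simp add: \<zeta>_def)
  then have vac: "0 \<in> \<zeta> ` {1..n}" using m by (rule configs_vacancy)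
  let ?c = "carried n \<zeta> ?J"
  \<comment> \<open>From \<open>?J\<close> the sweep first visits the unsorted sites up to
    \<open>n\<close>, then wraps around to the sorted sites \<open>1, ..., j\<close>, site
    \<open>a\<close> being at distance \<open>n - ?J + a\<close>.\<close>
  have s_hi: "?s d = ?J + d" if "d \<le> n - ?J" for d
    using that J by (simp add: clockwise_def)
  have s_lo: "?s (n - ?J + a) = a" if "1 \<le> a" "a \<le> j" for a
  proof -
    obtain a' where a': "a = Suc a'" using \<open>1 \<le> a\<close> by (cases a) auto
    then have "?J - 1 + (n - ?J + a) = n + a'" using J by simp
    then have "?s (n - ?J + a) = (n + a') mod n + 1" by (simp only: clockwise_def)
    then show ?thesis using that J a' by simp
  qed
  \<comment> \<open>Over the unsorted sites the sweep picks up their minimum, which is still at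
    least every sorted value.\<close>
  have c_hi: "\<zeta> a \<le> ?c d" if "d \<le> n - ?J" "1 \<le> a" "a \<le> j" for a d
    using that
  proof (induction d)
    case 0
    then show ?case using low[of a ?J] J by simp
  next
    case (Suc d)
    then show ?case using low[of a "?s (Suc d)"] s_hi[of "Suc d"] by simp
  qed
  \<comment> \<open>In the decreasing block each site surrenders its own value and keeps the larger
    one arriving. Thus the block shifts by one site and the minimum of the unsorted sites enters at
    site 1.\<close>
  have c_lo: "?c (n - ?J + a) = \<zeta> a" if "1 \<le> a" "a \<le> j" for a
    using that
  proof (induction a rule: nat_induct_at_least)
    case base
    then show ?case using c_hi[of "n - ?J" 1] s_lo[of 1] by simp
  next
    case (Suc a)
    then show ?case using dec[of a "Suc a"] s_lo[of "Suc a"] by simp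
  qed
  have new: "bells n ?J \<eta> (?s d) = (if d = 0 then 0 else max (?c (d - 1)) (\<zeta> (?s d)))" if "d < n" for d
    using bell_clockwise[OF J(1) vac that] by (simp add: \<zeta>_def)
  have new_J: "bells n ?J \<eta> ?J = 0"
    by (simp add: bell_def)
  have new_1: "bells n ?J \<eta> 1 = ?c (n - ?J)"
    using new[of "n - ?J + 1"] s_lo[of 1] c_hi[of "n - ?J" 1] Suc.hyps J by simp
  have new_lo: "bells n ?J \<eta> (Suc a) = \<zeta> a" if "1 \<le> a" "Suc a \<le> j" for a
    using new[of "n - ?J + Suc a"] s_lo[of "Suc a"] c_lo[of a] dec[of a "Suc a"] that J by simp
  have new_hi: "?c (n - ?J) \<le> bells n ?J \<eta> b" if "?J < b" "b \<le> n" for b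
    using new[of "b - ?J"] s_hi[of "b - ?J"] carried_antimono[of "b - ?J - 1" "n - ?J" n \<zeta> ?J] that
    by (simp add: le_max_iff_disj)
  have new_le: "bells n ?J \<eta> a \<le> ?c (n - ?J)" if "1 \<le> a" "a \<le> ?J" for a
  proof -
    consider "a = 1" | "a = ?J" | a' where "a = Suc a'" "1 \<le> a'" "Suc a' \<le> j"
      using \<open>1 \<le> a\<close> \<open>a \<le> ?J\<close> by (cases a) force+
    then show ?thesis
      using new_1 new_J new_lo c_hi[of "n - ?J"] by cases auto
  qed
  have "bells n ?J \<eta> b \<le> bells n ?J \<eta> a" if "1 \<le> a" "a < b" "b \<le> ?J" for a b
  proof -
    obtain b' where b': "b = Suc b'" "1 \<le> b'"
      using \<open>1 \<le> a\<close> \<open>a < b\<close> by (cases b) auto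
    consider "b = ?J" | "a = 1" | a' where "b \<le> j" "a = Suc a'" "1 \<le> a'"
      using \<open>1 \<le> a\<close> \<open>a < b\<close> \<open>b \<le> ?J\<close> by (cases a) force+
    then show ?thesis
    proof cases
      case 1
      then show ?thesis by (simp only: new_J le0)
    next
      case 2
      then show ?thesis using new_le[of b] new_1 that by simp
    next
      case (3 a')
      then show ?thesis using new_lo[of a'] new_lo[of b'] dec[of a' b'] b' that by simp
    qed
  qed
  moreover have "bells n ?J \<eta> a \<le> bells n ?J \<eta> b" if "1 \<le> a" "a \<le> ?J" "?J < b" "b \<le> n" for a b
    using new_le[of a] new_hi[of b] that by (meson le_trans)
  ultimately show ?case using new_J by blast
qed

lemma card_ge_configs:
  assumes "\<eta> \<in> configs n s m"
  shows "card {j \<in> {1..n}. r \<le> \<eta> j} = (\<Sum>q=r..s. m q)"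
proof -
  have "{j \<in> {1..n}. r \<le> \<eta> j} = (\<Union>q\<in>{r..s}. {j \<in> {1..n}. \<eta> j = q})"
    using assms by (auto simp: configs_def PiE_iff)
  also have "card \<dots> = (\<Sum>q=r..s. card {j \<in> {1..n}. \<eta> j = q})"
    by (rule card_UN_disjoint) auto
  also have "\<dots> = (\<Sum>q=r..s. m q)"
    using assms by (intro sum.cong) (auto simp: configs_def)
  finally show ?thesis .
qed

text \<open>In a decreasing configuration the sites with value at least \<open>r\<close> form an
  initial segment, whose length is fixed by the content. At a site \<open>l\<close> with
  \<open>f l < g l\<close>, the threshold \<open>g l\<close> would give \<open>f\<close> fewer than
  \<open>l\<close> such sites and \<open>g\<close> at least \<open>l\<close>.\<close>

lemma sorted_configs_unique:
  assumes \<eta>: "\<eta> \<in> configs n s m" and \<zeta>: "\<zeta> \<in> configs n s m"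
    and dec: "\<And>a b. 1 \<le> a \<Longrightarrow> a < b \<Longrightarrow> b \<le> n \<Longrightarrow> \<eta> b \<le> \<eta> a"
      "\<And>a b. 1 \<le> a \<Longrightarrow> a < b \<Longrightarrow> b \<le> n \<Longrightarrow> \<zeta> b \<le> \<zeta> a"
  shows "\<eta> = \<zeta>"
proof (rule configs_eqI[OF \<eta> \<zeta>])
  fix l assume l: "l \<in> {1..n}"
  have no_less: "\<not> f l < g l"
    if "f \<in> configs n s m" "g \<in> configs n s m"
      and f: "\<And>a b. 1 \<le> a \<Longrightarrow> a < b \<Longrightarrow> b \<le> n \<Longrightarrow> f b \<le> f a"
      and g: "\<And>a b. 1 \<le> a \<Longrightarrow> a < b \<Longrightarrow> b \<le> n \<Longrightarrow> g b \<le> g a" for f g :: "nat \<Rightarrow> nat"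
  proof
    assume less: "f l < g l"
    have "{j \<in> {1..n}. g l \<le> f j} \<subseteq> {1..<l}"
    proof
      fix j assume "j \<in> {j \<in> {1..n}. g l \<le> f j}"
      then show "j \<in> {1..<l}"
        using f[of l j] less l by (cases l j rule: linorder_cases) auto
    qed
    then have "card {j \<in> {1..n}. g l \<le> f j} \<le> l - 1"
      using card_mono[of "{1..<l}"] by simp
    moreover have "{1..l} \<subseteq> {j \<in> {1..n}. g l \<le> g j}"
    proof
      fix j assume "j \<in> {1..l}"
      then show "j \<in> {j \<in> {1..n}. g l \<le> g j}"
        using g[of j l] l by (cases "j = l") auto
    qed
    then have "l \<le> card {j \<in> {1..n}. g l \<le> g j}"
      using card_mono[of "{j \<in> {1..n}. g l \<le> g j}" "{1..l}"] by simp
    ultimately show False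
      using l card_ge_configs[OF that(1), of "g l"] card_ge_configs[OF that(2), of "g l"] by auto
  qed
  show "\<eta> l = \<zeta> l"
    using no_less[OF \<eta> \<zeta> dec] no_less[OF \<zeta> \<eta> dec(2,1)] by (simp add: not_less)
qed

lemma pushtasep_rate_nonneg:
  assumes "\<And>j. j \<in> {1..n} \<Longrightarrow> x j > 0"
  shows "pushtasep_rate n x \<eta> \<zeta> \<ge> 0"
  unfolding pushtasep_rate_def using assms by (intro sum_nonneg) (auto intro: less_imp_le)

lemma pushtasep_rate_bell_pos:
  assumes "\<And>j. j \<in> {1..n} \<Longrightarrow> x j > 0" "j \<in> {1..n}"
  shows "pushtasep_rate n x \<eta> (bell n j \<eta>) > 0"
  unfolding pushtasep_rate_def using assms by (intro sum_pos2[of _ j]) (auto intro: less_imp_le)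

lemma bells_reachable:
  assumes \<eta>: "\<eta> \<in> configs n s m" and m: "m 0 \<ge> 1" and pos: "\<And>j. j \<in> {1..n} \<Longrightarrow> x j > 0" and "j \<le> n"
  shows "(\<eta>, bells n j \<eta>) \<in>
    {(a, b). a \<in> configs n s m \<and> b \<in> configs n s m \<and> pushtasep_rate n x a b > 0}\<^sup>*"
  using \<open>j \<le> n\<close>
proof (induction j)
  case (Suc j)
  have "(bells n j \<eta>, bells n (Suc j) \<eta>) \<in>
      {(a, b). a \<in> configs n s m \<and> b \<in> configs n s m \<and> pushtasep_rate n x a b > 0}"
    using bells_in_configs[OF \<eta> m, of j] bells_in_configs[OF \<eta> m, of "Suc j"] Suc.prems
      pushtasep_rate_bell_pos[of n x "Suc j" "bells n j \<eta>"] pos by simp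
  then show ?case using Suc by (meson Suc_leD rtrancl.rtrancl_into_rtrancl)
qed simp

text \<open>The common target is the sorted configuration, which every configuration reaches through
  the bells \<open>1, ..., n\<close>, each of positive rate.\<close>

lemma pushtasep_invariant_unique:
  assumes m: "m 0 \<ge> 1" and n: "n \<ge> 1" and pos: "\<And>j. j \<in> {1..n} \<Longrightarrow> x j > 0"
    and v: "\<And>b. b \<in> configs n s m \<Longrightarrow>
      (\<Sum>a\<in>configs n s m. v a * generator (configs n s m) (pushtasep_rate n x) a b) = 0"
    and w: "\<And>b. b \<in> configs n s m \<Longrightarrow>
      (\<Sum>a\<in>configs n s m. w a * generator (configs n s m) (pushtasep_rate n x) a b) = 0"
    and sums: "(\<Sum>a\<in>configs n s m. v a) = (\<Sum>a\<in>configs n s m. w a)"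
    and \<eta>: "\<eta> \<in> configs n s m"
  shows "v \<eta> = w \<eta>"
proof (rule generator_invariant_unique[OF finite_configs _ _ v w sums \<eta>])
  have *: "bells n n a = bells n n \<eta>" if "a \<in> configs n s m" for a
    using bells_sorted[of _ n s m n] m n \<eta> that
    by (intro sorted_configs_unique[where m = m and s = s and n = n] bells_in_configs) auto
  show "(a, bells n n \<eta>) \<in>
      {(a, b). a \<in> configs n s m \<and> b \<in> configs n s m \<and> pushtasep_rate n x a b > 0}\<^sup>*"
    if "a \<in> configs n s m" for a
    using bells_reachable[where j = n and x = x, OF that m pos] *[OF that] by simp
qed (use pushtasep_rate_nonneg pos in auto)


section \<open>From finite-dimensional distributions to laws of observed paths\<close>

lemma enumerate_times:
  fixes J :: "real set"
  assumes "finite J" "J \<subseteq> {0..}"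
  shows "\<exists>(t :: nat \<Rightarrow> real) l. t 0 = 0 \<and> (\<forall>i<l. t i \<le> t (Suc i)) \<and> t ` {..l} = insert 0 J"
proof -
  \<comment> \<open>Time 0 is adjoined since the defining formula of \<open>markov_chain\<close>
    starts there.\<close>
  define T where "T = sorted_list_of_set (insert 0 J)"
  have T: "sorted T" "set T = insert 0 J"
    using set_sorted_list_of_set[of "insert 0 J"] assms(1)
    by (simp_all only: T_def sorted_sorted_list_of_set finite_insert)
  then have "T \<noteq> []" by auto
  have len: "{..length T - 1} = {..<length T}"
    using \<open>T \<noteq> []\<close> by (cases T) auto
  have "T ! 0 = 0"
  proof (rule antisym)
    obtain i where "i < length T" "T ! i = 0" using T(2) by (metis in_set_conv_nth insertI1)
    then show "T ! 0 \<le> 0" using sorted_nth_mono[OF T(1), of 0 i] by simp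
    have "T ! 0 \<in> insert 0 J" using T(2) \<open>T \<noteq> []\<close> by (metis length_greater_0_conv nth_mem)
    then show "T ! 0 \<ge> 0" using assms by auto
  qed
  moreover have "\<forall>i<length T - 1. T ! i \<le> T ! Suc i"
    using sorted_nth_mono[OF T(1)] by simp
  moreover have "(!) T ` {..length T - 1} = insert 0 J"
    unfolding len using T(2) nth_image[of "length T" T] by (simp add: atLeast0LessThan)
  ultimately show ?thesis by blast
qed

lemma measurable_observed_path:
  assumes "markov_chain M X S q \<mu>"
  shows "(\<lambda>\<omega>. \<lambda>t\<in>{0..}. restrict (X t \<omega>) {1..k}) \<in> measurable M (PiM {0..} (\<lambda>_. count_space UNIV))"
proof (rule measurable_restrict)
  fix t :: real assume "t \<in> {0..}"
  then have "X t \<in> measurable M (count_space S)"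
    using assms by (simp add: markov_chain_def)
  then show "(\<lambda>\<omega>. restrict (X t \<omega>) {1..k}) \<in> measurable M (count_space UNIV)"
    by (rule measurable_compose) simp
qed

text \<open>Laws on the product space are determined by finite cylinders. These are events about the
  chain at finitely many times that depend on the observed sites only, so \<open>K\<close> respects
  them.\<close>

lemma observed_path_law_eqI:
  assumes chain: "markov_chain M X S q \<mu>" "markov_chain M' X' S q' \<mu>'"
    and K: "intertwines S K q q'"
    and sum_K: "\<And>a. a \<in> S \<Longrightarrow> (\<Sum>b\<in>S. K a b) = 1"
    and observed_K: "\<And>a b. a \<in> S \<Longrightarrow> b \<in> S \<Longrightarrow> K a b \<noteq> 0 \<Longrightarrow> restrict a {1..k} = restrict b {1..k}"
    and \<mu>': "\<And>b. b \<in> S \<Longrightarrow> pmf \<mu>' b = (\<Sum>a\<in>S. pmf \<mu> a * K a b)"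
  shows "observed_path_law M X k = observed_path_law M' X' k"
proof -
  interpret M: prob_space M using chain by (simp add: markov_chain_def)
  interpret M': prob_space M' using chain by (simp add: markov_chain_def)
  have S: "finite S" using chain by (simp add: markov_chain_def)
  let ?P = "PiM {0..} (\<lambda>_. count_space UNIV) :: (real \<Rightarrow> nat \<Rightarrow> nat) measure"
  note meas = measurable_observed_path[OF chain(1), of k] measurable_observed_path[OF chain(2), of k]
  show ?thesis
    unfolding observed_path_law_def
  proof (rule measure_eqI_PiM_infinite[where I = "{0..}" and M = "\<lambda>_. count_space UNIV"])
    interpret D: prob_space "distr M ?P (\<lambda>\<omega>. \<lambda>t\<in>{0..}. restrict (X t \<omega>) {1..k})"
      by (rule M.prob_space_distr[OF meas(1)])
    show "finite_measure (distr M ?P (\<lambda>\<omega>. \<lambda>t\<in>{0..}. restrict (X t \<omega>) {1..k}))"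
      by (rule D.finite_measure_axioms)
    fix J :: "real set" and A :: "real \<Rightarrow> (nat \<Rightarrow> nat) set"
    assume J: "finite J" "J \<subseteq> {0..}"
    let ?C = "prod_emb {0..} (\<lambda>_. count_space UNIV) J (PiE J A)"
    obtain t :: "nat \<Rightarrow> real" and l where t: "t 0 = 0" "\<And>i. i < l \<Longrightarrow> t i \<le> t (Suc i)"
      and range: "t ` {..l} = insert 0 J"
      using enumerate_times[OF J] by blast
    \<comment> \<open>If time 0 was merely adjoined, it imposes no constraint.\<close>
    define B where "B i = {a \<in> S. t i \<in> J \<longrightarrow> restrict a {1..k} \<in> A (t i)}" for i
    have B: "B i \<subseteq> S" for i by (auto simp: B_def)
    have C: "?C \<in> sets ?P" using J by (intro sets_PiM_I) auto
    \<comment> \<open>Stated for an arbitrary chain and sample space, to serve both \<open>M\<close>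
      and \<open>M'\<close>.\<close>
    have cylinder: "emeasure (distr N ?P (\<lambda>\<omega>. \<lambda>t\<in>{0..}. restrict (Y t \<omega>) {1..k})) ?C
        = ennreal (\<Sum>b\<in>S. path_weight S (\<lambda>i. trans_prob S p (t (Suc i) - t i)) (pmf \<nu>) B l b)"
      if Y: "markov_chain N Y S p \<nu>" for N :: "'c measure" and Y p \<nu>
    proof -
      interpret N: prob_space N using Y by (simp add: markov_chain_def)
      have in_S: "Y u \<omega> \<in> S" if "u \<ge> 0" "\<omega> \<in> space N" for u \<omega>
        using Y that measurable_space[of "Y u" N "count_space S" \<omega>] by (simp add: markov_chain_def)
      have t_nonneg: "t i \<ge> 0" if "i \<le> l" for i
      proof -
        have "t i \<in> insert 0 J" using that range by blast
        then show ?thesis using J by auto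
      qed
      have "(\<lambda>\<omega>. \<lambda>t\<in>{0..}. restrict (Y t \<omega>) {1..k}) -` ?C \<inter> space N
          = {\<omega> \<in> space N. \<forall>i\<le>l. Y (t i) \<omega> \<in> B i}" (is "?L = ?R")
      proof (intro equalityI subsetI)
        fix \<omega> assume \<omega>: "\<omega> \<in> ?L"
        have "restrict (Y u \<omega>) {1..k} \<in> A u" if "u \<in> J" for u
        proof -
          have "0 \<le> u" using that J by auto
          moreover have "\<forall>u\<in>J. (\<lambda>t\<in>{0..}. restrict (Y t \<omega>) {1..k}) u \<in> A u"
            using \<omega> by (auto simp: prod_emb_def PiE_iff)
          ultimately show ?thesis using that by (auto dest!: bspec)
        qed
        then show "\<omega> \<in> ?R" using \<omega> in_S t_nonneg by (auto simp: B_def)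
      next
        fix \<omega> assume \<omega>: "\<omega> \<in> ?R"
        have "restrict (Y u \<omega>) {1..k} \<in> A u" if "u \<in> J" for u
        proof -
          have "u \<in> t ` {..l}" using range that by simp
          then obtain i where "i \<le> l" "t i = u" by auto
          then show ?thesis using \<omega> that by (auto simp: B_def)
        qed
        then show "\<omega> \<in> ?L" using \<omega> J by (auto simp: prod_emb_def PiE_iff)
      qed
      then show ?thesis
        unfolding emeasure_distr[OF measurable_observed_path[OF Y] C]
        using markov_chain_prob[where l = l and B = B and t = t, OF Y t B]
        by (simp add: N.emeasure_eq_measure)
    qed
    have "(\<Sum>b\<in>S. path_weight S (\<lambda>i. trans_prob S q' (t (Suc i) - t i)) (pmf \<mu>') B l b)
        = (\<Sum>b\<in>S. \<Sum>a\<in>S. path_weight S (\<lambda>i. trans_prob S q (t (Suc i) - t i)) (pmf \<mu>) B l a * K a b)"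
    proof (intro sum.cong refl path_weight_intertwined[OF S K] \<mu>')
      show "a \<in> B i \<longleftrightarrow> b \<in> B i" if "a \<in> S" "b \<in> S" "K a b \<noteq> 0" for i a b
        using observed_K[OF that] that by (simp add: B_def)
    qed
    \<comment> \<open>Summing over the final state removes \<open>K\<close>, whose rows sum to
      1.\<close>
    also have "\<dots> = (\<Sum>a\<in>S. path_weight S (\<lambda>i. trans_prob S q (t (Suc i) - t i)) (pmf \<mu>) B l a)"
      by (subst sum.swap) (simp add: sum_distrib_left[symmetric] sum_K)
    finally show "emeasure (distr M ?P (\<lambda>\<omega>. \<lambda>t\<in>{0..}. restrict (X t \<omega>) {1..k})) ?C
        = emeasure (distr M' ?P (\<lambda>\<omega>. \<lambda>t\<in>{0..}. restrict (X' t \<omega>) {1..k})) ?C"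
      unfolding cylinder[OF chain(1)] cylinder[OF chain(2)] by simp
  qed simp_all
qed

text \<open>\<open>\<mu> K Q' = \<mu> Q K = 0\<close> and \<open>\<mu> K\<close> has total mass 1. A
  priori it is a signed measure, which is why uniqueness was proved for real-valued
  functions.\<close>

lemma stationary_distribution_intertwined:
  assumes m: "m 0 \<ge> 1" and n: "n \<ge> 1" and pos: "\<And>j. j \<in> {1..n} \<Longrightarrow> x' j > 0"
    and K: "intertwines (configs n s m) K (pushtasep_rate n x) (pushtasep_rate n x')"
    and sum_K: "\<And>a. a \<in> configs n s m \<Longrightarrow> (\<Sum>b\<in>configs n s m. K a b) = 1"
    and \<mu>: "stationary_distribution (configs n s m) (pushtasep_rate n x) \<mu>"
    and \<mu>': "stationary_distribution (configs n s m) (pushtasep_rate n x') \<mu>'"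
    and "b \<in> configs n s m"
  shows "pmf \<mu>' b = (\<Sum>a\<in>configs n s m. pmf \<mu> a * K a b)"
proof (rule pushtasep_invariant_unique[OF m n pos _ _ _ \<open>b \<in> configs n s m\<close>])
  let ?S = "configs n s m"
  let ?g = "generator ?S (pushtasep_rate n x)" and ?g' = "generator ?S (pushtasep_rate n x')"
  show "(\<Sum>a\<in>?S. pmf \<mu>' a * ?g' a c) = 0" if "c \<in> ?S" for c
    by (rule stationary_distribution_generator[OF finite_configs \<mu>' that])
  show "(\<Sum>d\<in>?S. (\<Sum>a\<in>?S. pmf \<mu> a * K a d) * ?g' d c) = 0" if c: "c \<in> ?S" for c
  proof -
    have "(\<Sum>d\<in>?S. (\<Sum>a\<in>?S. pmf \<mu> a * K a d) * ?g' d c)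
        = (\<Sum>a\<in>?S. pmf \<mu> a * (\<Sum>d\<in>?S. K a d * ?g' d c))"
      unfolding sum_distrib_left sum_distrib_right by (subst sum.swap) (simp add: mult.assoc)
    also have "\<dots> = (\<Sum>a\<in>?S. pmf \<mu> a * (\<Sum>d\<in>?S. ?g a d * K d c))"
      using K c by (simp add: intertwines_def)
    also have "\<dots> = (\<Sum>d\<in>?S. (\<Sum>a\<in>?S. pmf \<mu> a * ?g a d) * K d c)"
      unfolding sum_distrib_left sum_distrib_right by (subst sum.swap) (simp add: mult.assoc)
    also have "\<dots> = 0"
      using stationary_distribution_generator[OF finite_configs \<mu>] by simp
    finally show ?thesis .
  qed
  have "(\<Sum>d\<in>?S. \<Sum>a\<in>?S. pmf \<mu> a * K a d) = (\<Sum>a\<in>?S. pmf \<mu> a)"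
    by (subst sum.swap) (simp add: sum_distrib_left[symmetric] sum_K)
  also have "\<dots> = 1"
    using \<mu> by (intro sum_pmf_eq_1 finite_configs) (simp add: stationary_distribution_def)
  also have "\<dots> = (\<Sum>a\<in>?S. pmf \<mu>' a)"
    using \<mu>' by (intro sum_pmf_eq_1[symmetric] finite_configs) (simp add: stationary_distribution_def)
  finally show "(\<Sum>a\<in>?S. pmf \<mu>' a) = (\<Sum>d\<in>?S. \<Sum>a\<in>?S. pmf \<mu> a * K a d)" ..
qed

theorem theorem2:
  fixes s n k :: nat and m :: "nat \<Rightarrow> nat" and x :: "nat \<Rightarrow> real" and \<sigma> :: "nat \<Rightarrow> nat"
    and M :: "'v measure" and M' :: "'w measure"
    and X :: "real \<Rightarrow> 'v \<Rightarrow> nat \<Rightarrow> nat" and X' :: "real \<Rightarrow> 'w \<Rightarrow> nat \<Rightarrow> nat"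
    and \<mu> \<mu>' :: "(nat \<Rightarrow> nat) pmf"
  assumes "n = (\<Sum>r\<le>s. m r)" and "m 0 \<ge> 1"
    and "\<And>j. j \<in> {1..n} \<Longrightarrow> x j > 0"
    and "1 \<le> k" and "k \<le> n - 1"
    and "\<sigma> permutes {k+1..n}"
    and "markov_chain M X (configs n s m) (pushtasep_rate n x) \<mu>"
    and "markov_chain M' X' (configs n s m) (pushtasep_rate n (x \<circ> \<sigma>)) \<mu>'"
    and "(stationary_distribution (configs n s m) (pushtasep_rate n x) \<mu> \<and>
          stationary_distribution (configs n s m) (pushtasep_rate n (x \<circ> \<sigma>)) \<mu>') \<or>
         (\<exists>\<eta>\<in>configs n s m. (\<forall>j\<in>{k+1..<n}. \<eta> j \<ge> \<eta> (j + 1)) \<and>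
            \<mu> = return_pmf \<eta> \<and> \<mu>' = return_pmf \<eta>)"
  shows "observed_path_law M X k = observed_path_law M' X' k"
proof -
  obtain K where K: "hidden_change n s m k x (x \<circ> \<sigma>) K"
    using hidden_change_permutes[where m = m and x = x, OF assms(2,6,3)] by blast
  \<comment> \<open>Both kinds of start reduce to the single condition
    \<open>\<mu>' = \<mu> K\<close>: by uniqueness of the stationary distribution, or because
    \<open>K\<close> fixes \<open>\<eta>\<close>.\<close>
  have "pmf \<mu>' b = (\<Sum>a\<in>configs n s m. pmf \<mu> a * K a b)" if b: "b \<in> configs n s m" for b
    using assms(9)
  proof (elim disjE bexE conjE)
    assume st: "stationary_distribution (configs n s m) (pushtasep_rate n x) \<mu>"
      "stationary_distribution (configs n s m) (pushtasep_rate n (x \<circ> \<sigma>)) \<mu>'"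
    have "\<sigma> permutes {1..n}"
      using assms(6) by (rule permutes_subset) auto
    then have "(x \<circ> \<sigma>) j > 0" if "j \<in> {1..n}" for j
      using assms(3) that by (simp only: comp_def permutes_in_image)
    moreover have "n \<ge> 1" using assms(4,5) by simp
    ultimately show ?thesis
      using K assms(2) st b
      by (intro stationary_distribution_intertwined[where m = m and x = x and x' = "x \<circ> \<sigma>"])
        (auto simp: hidden_change_def)
  next
    fix \<eta> assume \<eta>: "\<eta> \<in> configs n s m" "\<forall>j\<in>{k+1..<n}. \<eta> j \<ge> \<eta> (j + 1)"
      and \<mu>: "\<mu> = return_pmf \<eta>" "\<mu>' = return_pmf \<eta>"
    have "K \<eta> b = of_bool (b = \<eta>)"
      using K \<eta> b unfolding hidden_change_def by blast
    moreover have "(\<Sum>a\<in>configs n s m. pmf \<mu> a * K a b) = (\<Sum>a\<in>configs n s m. if a = \<eta> then K a b else 0)"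
      by (intro sum.cong) (auto simp: \<mu> pmf_return)
    ultimately show ?thesis using \<eta> by (auto simp: \<mu> pmf_return finite_configs)
  qed
  then show ?thesis
    using K by (intro observed_path_law_eqI[OF assms(7,8)]) (auto simp: hidden_change_def)
qed

end
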